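(* Let $a,b,c,d,e,f,g,h$ be nonzero complex numbers with $bcdefgh=a^3q^2$. Fix any one of the seven positions $b,c,d,e,f,g,h$ as the distinguished one and let $\Phi(a;b,c,d,e,f,g,h)$ denote the corresponding function $\Phi^{(p)}(a;b,c,d,e,f,g,h;q)$ (the distinguished position stays the same in all terms below). Put $\Phi=\Phi(a;b,c,d,e,f,g,h)$, $\Phi(g-,h+)=\Phi(a;b,c,d,e,f,g/q,hq)$, $\Phi(h-,g+)=\Phi(a;b,c,d,e,f,gq,h/q)$. Then $$\frac{g(1-h)(1-\frac ah)(1-\frac{aq}{h})\prod_{p\in\{b,c,d,e,f\}}(1-\frac{aq}{gp})}{1-\frac{hq}{g}}\bigl[\Phi(g-,h+)-\Phi\bigr]$$ $$-\frac{h(1-g)(1-\frac ag)(1-\frac{aq}{g})\prod_{p\in\{b,c,d,e,f\}}(1-\frac{aq}{hp})}{1-\frac{gq}{h}}\bigl[\Phi(h-,g+)-\Phi\bigr]$$ $$-\frac{aq}{h}\Bigl(1-\frac hg\Bigr)\Bigl(1-\frac{gh}{aq}\Bigr)(1-b)(1-c)(1-d)(1-e)(1-f)\,\Phi=0 .$$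
   Context: Throughout $q\in\mathbb C$, $0<|q|<1$; $(x)_0=1$, $(x)_k=\prod_{j=0}^{k-1}(1-xq^j)$, $(x)_\infty=\prod_{j\ge 0}(1-xq^j)$, and $(x_1,\dots,x_r)_k=\prod_i (x_i)_k$ for $k\in\mathbb{Z}_{\ge0}\cup\{\infty\}$. Products over $p\in\{b,c,\dots\}$ are over the listed letters, with multiplicity. The balanced very-well-poised series is $${}_{10}W_9(a;p_1,\dots,p_7;q)=\sum_{k=0}^\infty \frac{1-aq^{2k}}{1-a}\,\frac{(a,p_1,\dots,p_7)_k}{(q,aq/p_1,\dots,aq/p_7)_k}\,q^k,\qquad p_1p_2\cdots p_7=a^3q^2 .$$ For a distinguished position $i$, with $p=p_i$, $$\Phi^{(p)}(a;p_1,\dots,p_7;q)={}_{10}W_9(a;p_1,\dots,p_7;q)+\frac{(aq,\,p_i/a)_\infty}{(p_i^2q/a,\,a/p_i)_\infty}\prod_{j\ne i}\frac{(p_j,\;p_iq/p_j)_\infty}{(aq/p_j,\;p_ip_j/a)_\infty}\;{}_{10}W_9\Bigl(\tfrac{p_i^2}{a};\,p_i,\bigl(\tfrac{p_ip_j}{a}\bigr)_{j\ne i};q\Bigr).$$ Standing assumption: parameters are such that no zero denominators (singularities) occur; in particular $a$ is different from the distinguished parameter. *)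

theory Defs
  imports "HOL-Analysis.Analysis"
begin

definition qpoch :: "complex \<Rightarrow> complex \<Rightarrow> nat \<Rightarrow> complex" where
  "qpoch x q k = (\<Prod>j<k. 1 - x * q ^ j)"

definition qpoch_inf :: "complex \<Rightarrow> complex \<Rightarrow> complex" where
  "qpoch_inf x q = (\<Prod>j. 1 - x * q ^ j)"

(* The very-well-poised series, with the parameters p_1, ..., p_7 passed as a list.
   Neither the length 7 nor the balancing condition p_1 ... p_7 = a^3 q^2 is built in. *)
definition W10_9 :: "complex \<Rightarrow> complex list \<Rightarrow> complex \<Rightarrow> complex" where
  "W10_9 a ps q =
     (\<Sum>k. (1 - a * q ^ (2 * k)) / (1 - a)
        * ((qpoch a q k * (\<Prod>p\<leftarrow>ps. qpoch p q k))
            / (qpoch q q k * (\<Prod>p\<leftarrow>ps. qpoch (a * q / p) q k)))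
        * q ^ k)"

(* The list of the parameters p_j with j different from i (0-based positions). *)
definition others :: "nat \<Rightarrow> 'a list \<Rightarrow> 'a list" where
  "others i ps = take i ps @ drop (Suc i) ps"

(* Phi with distinguished parameter p_i = ps ! i. *)
definition Phi :: "nat \<Rightarrow> complex \<Rightarrow> complex list \<Rightarrow> complex \<Rightarrow> complex" where
  "Phi i a ps q =
     (let p = ps ! i; rs = others i ps in
        W10_9 a ps q
        + (qpoch_inf (a * q) q * qpoch_inf (p / a) q)
            / (qpoch_inf (p\<^sup>2 * q / a) q * qpoch_inf (a / p) q)
          * (\<Prod>r\<leftarrow>rs. (qpoch_inf r q * qpoch_inf (p * q / r) q)
                       / (qpoch_inf (a * q / r) q * qpoch_inf (p * r / a) q))
          * W10_9 (p\<^sup>2 / a) (p # map (\<lambda>r. p * r / a) rs) q)"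

(* No denominator in the series vanishes; the factors (q)_k are never zero for |q| < 1. *)
definition W10_9_regular :: "complex \<Rightarrow> complex list \<Rightarrow> complex \<Rightarrow> bool" where
  "W10_9_regular a ps q \<longleftrightarrow>
     1 - a \<noteq> 0 \<and> (\<forall>p\<in>set ps. p \<noteq> 0 \<and> (\<forall>k. qpoch (a * q / p) q k \<noteq> 0))"

(* No denominator in Phi vanishes: neither in the two series nor in the prefactor.
   The condition on (a/p)_infinity contains a \<noteq> p. *)
definition Phi_regular :: "nat \<Rightarrow> complex \<Rightarrow> complex list \<Rightarrow> complex \<Rightarrow> bool" where
  "Phi_regular i a ps q \<longleftrightarrow>
     (let p = ps ! i; rs = others i ps in
        a \<noteq> 0 \<and> W10_9_regular a ps q
        \<and> W10_9_regular (p\<^sup>2 / a) (p # map (\<lambda>r. p * r / a) rs) q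
        \<and> qpoch_inf (p\<^sup>2 * q / a) q \<noteq> 0 \<and> qpoch_inf (a / p) q \<noteq> 0
        \<and> (\<forall>r\<in>set rs. qpoch_inf (a * q / r) q \<noteq> 0 \<and> qpoch_inf (p * r / a) q \<noteq> 0))"

end

theory Submission
  imports Defs
begin

text \<open>
  Up to a constant factor, the two series in \<open>\<Phi>\<close> are the sums of one function
  \<open>F(x) = (1 - a x\<^sup>2) x (q x, a q x / p\<^sub>1, \<dots>, a q x / p\<^sub>7)\<^sub>\<infinity> / (a x, p\<^sub>1 x, \<dots>, p\<^sub>7 x)\<^sub>\<infinity>\<close>
  over the grids \<open>x = q\<^sup>k\<close> and \<open>x = (p / a) q\<^sup>k\<close>, taken with opposite signs. The contiguous
  combination of the functions belonging to the three parameter sets is of the form \<open>G(q x) - G(x)\<close>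
  with \<open>G(x) / F(x)\<close> rational. On both grids the telescoping sum reduces to the same limit
  as \<open>x \<rightarrow> 0\<close>, so the two contributions cancel. If the distinguished parameter is \<open>g\<close> or \<open>h\<close>,
  the second grid is itself shifted by one step between the three parameter sets.
\<close>

subsection \<open>Shifted factorials\<close>

text \<open>The shape of the argument is set by exceptional parameters that the standing assumption
  admits. Expressing the three summands through one common factor costs a division by (1 - g y /
  q)(1 - h y / q), where y is the start of the grid. Regularity of the shifted functions excludes
  its zeros on the second grid if the distinguished parameter is one of b, ..., f. On the first grid
  g = q or h = q is not excluded, so the point x = 1 is split off and the telescoping starts at x =
  q. If g itself is distinguished, two points need separate treatment. For this reason the relation
  on one grid is stated for arbitrary weights of the three series, tied together by equations with
  cleared denominators.

  The two grids are natural starting points because G contains the factors 1 - x and 1 - a x / p for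
  p among b, ..., f: these vanish at x = 1 and at x = p / a, so that no lower boundary term arises
  there. The prefactor in Phi is the normalisation that makes the two limits agree up to
  sign.\<close>

lemma qpoch_0 [simp]: "qpoch x q 0 = 1"
  by (simp add: qpoch_def)

lemma qpoch_Suc: "qpoch x q (Suc k) = qpoch x q k * (1 - x * q ^ k)"
  by (simp add: qpoch_def)

lemma qpoch_Suc_shift: "qpoch x q (Suc k) = (1 - x) * qpoch (x * q) q k"
  by (simp add: qpoch_def prod.lessThan_Suc_shift mult.assoc del: prod.lessThan_Suc)

lemma qpoch_shift: "(1 - x) * qpoch (x * q) q k = qpoch x q k * (1 - x * q ^ k)"
  by (simp flip: qpoch_Suc qpoch_Suc_shift)

lemma qpoch_nonzero_less: "qpoch x q k \<noteq> 0 \<Longrightarrow> j < k \<Longrightarrow> 1 - x * q ^ j \<noteq> 0"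
  by (auto simp: qpoch_def)

lemma qpoch_convergent_prod:
  assumes "norm q < 1"
  shows "convergent_prod (\<lambda>j. 1 - x * q ^ j :: complex)"
proof -
  have "summable (\<lambda>j. norm x * norm q ^ j)"
    using assms by (intro summable_mult summable_geometric) simp
  then have "abs_convergent_prod (\<lambda>j. 1 - x * q ^ j)"
    by (intro summable_imp_abs_convergent_prod) (simp add: norm_mult norm_power)
  then show ?thesis
    by (rule abs_convergent_prod_imp_convergent_prod)
qed

lemma qpoch_LIMSEQ:
  assumes "norm q < 1"
  shows "qpoch x q \<longlonglongrightarrow> qpoch_inf x q"
proof -
  have "(\<lambda>n. \<Prod>j\<le>n. 1 - x * q ^ j) \<longlonglongrightarrow> qpoch_inf x q"
    unfolding qpoch_inf_def by (intro convergent_prod_LIMSEQ qpoch_convergent_prod assms)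
  then have "(\<lambda>n. qpoch x q (Suc n)) \<longlonglongrightarrow> qpoch_inf x q"
    by (simp add: qpoch_def lessThan_Suc_atMost del: prod.lessThan_Suc)
  then show ?thesis
    by (rule LIMSEQ_imp_Suc)
qed

lemma qpoch_inf_rec:
  assumes "norm q < 1"
  shows "qpoch_inf x q = (1 - x) * qpoch_inf (x * q) q"
proof (rule LIMSEQ_unique)
  show "(\<lambda>n. qpoch x q (Suc n)) \<longlonglongrightarrow> qpoch_inf x q"
    using qpoch_LIMSEQ[OF assms] by (rule LIMSEQ_Suc)
  show "(\<lambda>n. qpoch x q (Suc n)) \<longlonglongrightarrow> (1 - x) * qpoch_inf (x * q) q"
    unfolding qpoch_Suc_shift by (intro tendsto_intros qpoch_LIMSEQ assms)
qed

lemma qpoch_inf_rec_div: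
  assumes "norm q < 1" "q \<noteq> 0"
  shows "qpoch_inf (x / q) q = (1 - x / q) * qpoch_inf x q"
  using qpoch_inf_rec[OF assms(1), of "x / q"] assms(2) by simp

text \<open>Convergence in the sense of \<open>convergent_prod\<close> excludes the value 0 unless a
  factor is 0, so it is enough that no factor vanishes.\<close>

lemma qpoch_inf_nonzero:
  assumes "norm q < 1" "\<And>k. qpoch x q k \<noteq> 0"
  shows "qpoch_inf x q \<noteq> 0"
  unfolding qpoch_inf_def
  using qpoch_nonzero_less[OF assms(2) lessI]
  by (intro prodinf_nonzero qpoch_convergent_prod assms(1)) auto

lemma qpoch_nonzero:
  assumes "norm q < 1" "qpoch_inf x q \<noteq> 0"
  shows "qpoch x q k \<noteq> 0"
  using assms(2)
proof (induction k arbitrary: x)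
  case (Suc k)
  then show ?case
    using qpoch_inf_rec[OF assms(1), of x] by (auto simp: qpoch_Suc_shift)
qed simp

lemma qpoch_inf_self_nonzero:
  assumes "norm q < 1"
  shows "qpoch_inf q q \<noteq> 0"
proof (rule qpoch_inf_nonzero[OF assms])
  have "q ^ Suc j \<noteq> 1" for j
  proof
    assume "q ^ Suc j = 1"
    then have "norm q ^ Suc j = 1"
      by (metis norm_one norm_power)
    then show False
      using power_Suc_less_one[of "norm q" j] assms by (cases "q = 0") auto
  qed
  then show "qpoch q q k \<noteq> 0" for k
    by (simp add: qpoch_def)
qed

lemma prod_list_map_mult:
  "(\<Prod>p\<leftarrow>ps. f p * g p) = (\<Prod>p\<leftarrow>ps. f p) * (\<Prod>p\<leftarrow>ps. g p :: 'a :: comm_monoid_mult)"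
  by (induction ps) (simp_all add: mult_ac)

lemma prod_list_map_divide:
  "(\<Prod>p\<leftarrow>ps. f p / g p) = (\<Prod>p\<leftarrow>ps. f p) / (\<Prod>p\<leftarrow>ps. g p :: 'a :: field)"
  by (induction ps) simp_all

lemma prod_list_map_nonzero:
  fixes f :: "'b \<Rightarrow> 'a :: idom"
  assumes "\<And>p. p \<in> set ps \<Longrightarrow> f p \<noteq> 0"
  shows "(\<Prod>p\<leftarrow>ps. f p) \<noteq> 0"
  using assms by (induction ps) auto

lemma tendsto_prod_list:
  fixes f :: "'b \<Rightarrow> 'a \<Rightarrow> complex"
  assumes "\<And>p. p \<in> set ps \<Longrightarrow> (f p \<longlongrightarrow> l p) F"
  shows "((\<lambda>k. \<Prod>p\<leftarrow>ps. f p k) \<longlongrightarrow> (\<Prod>p\<leftarrow>ps. l p)) F"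
  using assms by (induction ps) (auto intro!: tendsto_intros)

subsection \<open>The telescoping identity\<close>

text \<open>
  Here \<open>e\<^sub>1, \<dots>, e\<^sub>4\<close> are elementary symmetric functions of \<open>b, \<dots>, f\<close>, and
  \<open>u = a q / g\<close>, \<open>v = a q / h\<close>, \<open>s = g h / (a q\<^sup>2)\<close>; balancing turns \<open>e\<^sub>5\<close> into \<open>s u\<^sup>2 v\<^sup>2\<close>.
\<close>
lemma contiguous_polynomial_identity:
  fixes s u v x e1 e2 e3 e4 :: complex
  defines "e5 \<equiv> s * u^2 * v^2" and "w \<equiv> s * u * v * x"
  defines "E \<equiv> \<lambda>y. y^5 - e1 * y^4 + e2 * y^3 - e3 * y^2 + e4 * y - e5"
  shows "((1 - v) * (1 - u) * (v - u)) *
      ((1 - w) * (1 - s * v * x) * (1 - s * u * x) * e5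
          * (1 - e1 * x + e2 * x^2 - e3 * x^3 + e4 * x^4 - e5 * x^5)
        + ((1 - x) * (1 - u * x) * (1 - v * x)) * E w)
    = (x * (1 - w * x) * (s * v^2 * (1 - v) * (1 - x) * (1 - w) * (1 - s * u * x) * (1 - v * x))) * E u
      + (- x * (1 - w * x) * (s * u^2 * (1 - u) * (1 - x) * (1 - w) * (1 - s * v * x) * (1 - u * x))) * E v
      + (x * (1 - w * x) * (v - u) * e5 * (1 - s * v * x) * (1 - u * x) * (1 - s * u * x) * (1 - v * x))
        * (1 - e1 + e2 - e3 + e4 - e5)"
  unfolding E_def e5_def w_def by algebra

text \<open>What remains of the weighted difference between the summands for (g / q, h q) and (g, h)
  after the common factor is taken out; see \<open>shift_diff\<close>.\<close>

definition wp_diff :: "complex \<Rightarrow> complex \<Rightarrow> complex list \<Rightarrow> complex \<Rightarrow> complex \<Rightarrow> complex \<Rightarrow> complex" where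
  "wp_diff a q ps g h x = - (g\<^sup>2 / q * (1 - a * q / h) * (\<Prod>p\<leftarrow>ps. 1 - a * q / (g * p))
     * (1 - x) * (1 - a * x) * (1 - h * x / q) * (1 - a * q * x / h))"

text \<open>The unshifted summand relative to the same common factor; see
  \<open>vwp_term_eq\<close>.\<close>

definition wp_coeff :: "complex \<Rightarrow> complex \<Rightarrow> complex \<Rightarrow> complex \<Rightarrow> complex \<Rightarrow> complex" where
  "wp_coeff a q g h x = (1 - g * x / q) * (1 - a * q * x / g) * ((1 - h * x / q) * (1 - a * q * x / h))"

text \<open>Divided by the common factor of the summands, G(q x) - G(x) becomes the left-hand side
  and the combination of the three summands the right-hand side. In the coordinates
  \<open>u\<close>, \<open>v\<close>, \<open>s\<close> the parameters g = q s v, h = q s u and a = s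
  u v are monomials, and balancing determines the product of b, ..., f. What remains is the
  preceding polynomial identity.\<close>

lemma contiguous_key:
  assumes len: "length ps = 5" and nz: "0 \<notin> set ps" "a \<noteq> 0" "q \<noteq> 0" "g \<noteq> 0" "h \<noteq> 0"
    and bal: "prod_list ps * g * h = a^3 * q\<^sup>2"
  shows "(1 - a * q / h) * (1 - a * q / g) * (g - h) *
      ((1 - a * x) * (\<Prod>p\<leftarrow>ps. 1 - p * x) * (1 - g * x / q) * (1 - h * x / q)
       - (1 - x) * (\<Prod>p\<leftarrow>ps. 1 - a * x / p) * (1 - a * q * x / g) * (1 - a * q * x / h))
    = x * (1 - a * x\<^sup>2) * (wp_diff a q ps g h x - wp_diff a q ps h g x
        + (g - h) * (\<Prod>p\<leftarrow>ps. 1 - p) * wp_coeff a q g h x)"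
proof -
  obtain b c d e f where ps: "ps = [b, c, d, e, f]"
    using len by (auto simp: length_Suc_conv eval_nat_numeral)
  have nz': "b \<noteq> 0" "c \<noteq> 0" "d \<noteq> 0" "e \<noteq> 0" "f \<noteq> 0"
    using nz(1) by (auto simp: ps)
  define u v s where "u = a * q / g" and "v = a * q / h" and "s = g * h / (a * q\<^sup>2)"
  have uvs: "u \<noteq> 0" "v \<noteq> 0" "s \<noteq> 0"
    using nz by (auto simp: u_def v_def s_def)
  have g: "g = q * s * v" and h: "h = q * s * u" and a: "a = s * u * v"
    using nz by (simp_all add: u_def v_def s_def field_simps power2_eq_square)
  define e1 where "e1 = b + c + d + e + f"
  define e2 where "e2 = b*c + b*d + b*e + b*f + c*d + c*e + c*f + d*e + d*f + e*f"
  define e3 where "e3 = b*c*d + b*c*e + b*c*f + b*d*e + b*d*f + b*e*f + c*d*e + c*d*f + c*e*f + d*e*f"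
  define e4 where "e4 = b*c*d*e + b*c*d*f + b*c*e*f + b*d*e*f + c*d*e*f"
  define e5 where "e5 = s * u^2 * v^2"
  define E where "E = (\<lambda>y. y^5 - e1 * y^4 + e2 * y^3 - e3 * y^2 + e4 * y - e5)"
  have e5: "e5 = b * c * d * e * f"
  proof -
    have "e5 * (q\<^sup>2 * s * u * v * s) = b * c * d * e * f * (q\<^sup>2 * s * u * v * s)"
      using bal unfolding ps e5_def g h a by (auto simp: algebra_simps power2_eq_square power3_eq_cube)
    moreover have "q\<^sup>2 * s * u * v * s \<noteq> 0"
      using uvs nz by simp
    ultimately show ?thesis
      using mult_right_cancel by blast
  qed
  have e50: "e5 \<noteq> 0"
    using nz' by (simp add: e5)
  have E: "E y = (y - b) * (y - c) * (y - d) * (y - e) * (y - f)" for y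
    unfolding E_def e5 e1_def e2_def e3_def e4_def by algebra
  have P: "(\<Prod>p\<leftarrow>ps. 1 - p * y) = 1 - e1 * y + e2 * y^2 - e3 * y^3 + e4 * y^4 - e5 * y^5" for y
    unfolding ps e5 e1_def e2_def e3_def e4_def list.map prod_list.Cons prod_list.Nil by algebra
  have D: "(\<Prod>p\<leftarrow>ps. 1 - y / p) = - E y / e5" for y
    using nz' unfolding ps E e5 by (simp add: field_simps)
  have Du: "(\<Prod>p\<leftarrow>ps. 1 - a * q / (g * p)) = - E u / e5" "(\<Prod>p\<leftarrow>ps. 1 - a * q / (h * p)) = - E v / e5"
    using D[of u] D[of v] by (simp_all add: u_def v_def)
  have simps: "a * q / g = u" "a * q / h = v" "a * q * x / g = u * x" "a * q * x / h = v * x"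
      "g * x / q = s * v * x" "h * x / q = s * u * x" "g\<^sup>2 / q = q * s\<^sup>2 * v\<^sup>2" "h\<^sup>2 / q = q * s\<^sup>2 * u\<^sup>2"
      "g - h = q * s * (v - u)"
    using nz unfolding u_def v_def s_def by (simp_all add: field_simps power2_eq_square)
  \<comment> \<open>The products of 1 - y / p bring in the denominator \<open>e5\<close>. This step
    multiplies it out, which makes the polynomial identity applicable.\<close>
  have clear: "q * s * (k * (m * p - n * (- y / e5))) = q * s * (- (r1 * (- yu / e5)) - r2 * (- yv / e5) + r3 * y1)"
    if "k * (m * e5 * p + n * y) = r1 * yu + r2 * yv + r3 * e5 * y1" for k m n p y r1 r2 r3 yu yv y1
  proof -
    have "k * (m * p - n * (- y / e5)) = k * (m * e5 * p + n * y) / e5"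
      using e50 by (simp add: field_simps)
    also have "\<dots> = - (r1 * (- yu / e5)) - r2 * (- yv / e5) + r3 * y1"
      unfolding that using e50 by (simp add: field_simps)
    finally show ?thesis
      by simp
  qed
  have "(1 - v) * (1 - u) * (q * s * (v - u)) *
      ((1 - s * u * v * x) * (\<Prod>p\<leftarrow>ps. 1 - p * x) * (1 - s * v * x) * (1 - s * u * x)
       - (1 - x) * (- E (s * u * v * x) / e5) * (1 - u * x) * (1 - v * x))
    = q * s * (((1 - v) * (1 - u) * (v - u)) *
      (((1 - s * u * v * x) * (1 - s * v * x) * (1 - s * u * x)) * (\<Prod>p\<leftarrow>ps. 1 - p * x)
       - ((1 - x) * (1 - u * x) * (1 - v * x)) * (- E (s * u * v * x) / e5)))"
    by (simp only: mult_ac)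
  also have "\<dots> = q * s * (- (x * (1 - s * u * v * x * x) * (s * v^2 * (1 - v) * (1 - x) * (1 - s * u * v * x) * (1 - s * u * x) * (1 - v * x)) * (- E u / e5))
      - (- x * (1 - s * u * v * x * x) * (s * u^2 * (1 - u) * (1 - x) * (1 - s * u * v * x) * (1 - s * v * x) * (1 - u * x))) * (- E v / e5)
      + (x * (1 - s * u * v * x * x) * (v - u) * (1 - s * v * x) * (1 - u * x) * (1 - s * u * x) * (1 - v * x))
        * (\<Prod>p\<leftarrow>ps. 1 - p * 1))"
    by (rule clear, unfold P E_def e5_def,
        use contiguous_polynomial_identity[of v u s x e1 e2 e3 e4] in \<open>simp add: mult_ac\<close>)
  also have "\<dots> = x * (1 - s * u * v * x\<^sup>2) * (
      - (q * s\<^sup>2 * v\<^sup>2 * (1 - v) * (- E u / e5) * (1 - x) * (1 - s * u * v * x) * (1 - s * u * x) * (1 - v * x))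
      - - (q * s\<^sup>2 * u\<^sup>2 * (1 - u) * (- E v / e5) * (1 - x) * (1 - s * u * v * x) * (1 - s * v * x) * (1 - u * x))
      + (q * s * (v - u)) * (\<Prod>p\<leftarrow>ps. 1 - p) * ((1 - s * v * x) * (1 - u * x) * ((1 - s * u * x) * (1 - v * x))))"
  proof -
    have reassoc: "q * s * (- (x * w * (s * v2 * t1) * y1) - (- x * w * (s * u2 * t2)) * y2 + (x * w * d * t3) * p)
      = x * w * (- (q * s\<^sup>2 * v2 * t1 * y1) - - (q * s\<^sup>2 * u2 * t2 * y2) + (q * s * d) * p * t3)"
      for w v2 t1 y1 u2 t2 y2 d t3 p
      by (simp add: algebra_simps power2_eq_square)
    show ?thesis
      using reassoc[of "1 - s * u * v * x * x" "v\<^sup>2"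
          "(1 - v) * (1 - x) * (1 - s * u * v * x) * (1 - s * u * x) * (1 - v * x)" "- E u / e5" "u\<^sup>2"
          "(1 - u) * (1 - x) * (1 - s * u * v * x) * (1 - s * v * x) * (1 - u * x)" "- E v / e5" "v - u"
          "(1 - s * v * x) * (1 - u * x) * (1 - s * u * x) * (1 - v * x)" "\<Prod>p\<leftarrow>ps. 1 - p"]
      by (simp only: mult_ac power2_eq_square mult_1_right)
  qed
  finally show ?thesis
    unfolding wp_diff_def wp_coeff_def simps Du D unfolding a .
qed

text \<open>
  The common factor of the three summands, on the grid \<open>x = y q\<^sup>k\<close>: the numerators carry \<open>g / q\<close>
  and \<open>h / q\<close>, the denominators one factor more, so that each summand is a polynomial in \<open>x\<close> times it.
\<close>
definition wp_ratio :: "complex \<Rightarrow> complex \<Rightarrow> complex \<Rightarrow> complex list \<Rightarrow> complex \<Rightarrow> complex \<Rightarrow> nat \<Rightarrow> complex" where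
  "wp_ratio a y q ps g h k =
     (qpoch (a * y) q k * (\<Prod>p\<leftarrow>ps. qpoch (p * y) q k) * qpoch (g * y / q) q k * qpoch (h * y / q) q k)
     / (qpoch (q * y) q k * (\<Prod>p\<leftarrow>ps. qpoch (a * q * y / p) q k)
        * qpoch (a * q * y / g) q (Suc k) * qpoch (a * q * y / h) q (Suc k))"

definition wp_ratio_inf :: "complex \<Rightarrow> complex \<Rightarrow> complex \<Rightarrow> complex list \<Rightarrow> complex \<Rightarrow> complex \<Rightarrow> complex" where
  "wp_ratio_inf a y q ps g h =
     (qpoch_inf (a * y) q * (\<Prod>p\<leftarrow>ps. qpoch_inf (p * y) q) * qpoch_inf (g * y / q) q * qpoch_inf (h * y / q) q)
     / (qpoch_inf (q * y) q * (\<Prod>p\<leftarrow>ps. qpoch_inf (a * q * y / p) q)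
        * qpoch_inf (a * q * y / g) q * qpoch_inf (a * q * y / h) q)"

definition wp_regular :: "complex \<Rightarrow> complex \<Rightarrow> complex \<Rightarrow> complex list \<Rightarrow> complex \<Rightarrow> complex \<Rightarrow> bool" where
  "wp_regular a y q ps g h \<longleftrightarrow> (\<forall>k. qpoch (q * y) q k \<noteq> 0 \<and> (\<forall>p\<in>set ps. qpoch (a * q * y / p) q k \<noteq> 0)
     \<and> qpoch (a * q * y / g) q k \<noteq> 0 \<and> qpoch (a * q * y / h) q k \<noteq> 0)"

lemma wp_ratio_commute: "wp_ratio a y q ps g h k = wp_ratio a y q ps h g k"
  by (simp add: wp_ratio_def mult_ac)

text \<open>The factors on the left are those by which G multiplies the common factor at the next
  grid point, so G(q x) becomes a multiple of \<open>wp_ratio\<close> at k.\<close>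

lemma wp_ratio_Suc:
  assumes "wp_regular a y q ps g h"
  defines "x \<equiv> \<lambda>k. y * q ^ k"
  shows "wp_ratio a y q ps g h (Suc k) * ((1 - q * x k) * (\<Prod>p\<leftarrow>ps. 1 - a * q * x k / p)
           * (1 - a * q * x (Suc k) / g) * (1 - a * q * x (Suc k) / h))
       = wp_ratio a y q ps g h k * ((1 - a * x k) * (\<Prod>p\<leftarrow>ps. 1 - p * x k)
           * (1 - g * x k / q) * (1 - h * x k / q))"
proof -
  have reg: "qpoch (q * y) q (Suc k) \<noteq> 0" "qpoch (a * q * y / g) q (Suc (Suc k)) \<noteq> 0"
    "qpoch (a * q * y / h) q (Suc (Suc k)) \<noteq> 0" "\<And>p. p \<in> set ps \<Longrightarrow> qpoch (a * q * y / p) q (Suc k) \<noteq> 0"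
    using assms(1) unfolding wp_regular_def by simp_all
  note nz = reg(1-3)[THEN qpoch_nonzero_less, OF lessI]
  have "1 - a * q * y / p * q ^ k \<noteq> 0" if "p \<in> set ps" for p
    using reg(4)[OF that] by (rule qpoch_nonzero_less[OF _ lessI])
  then have nz': "(\<Prod>p\<leftarrow>ps. 1 - a * q * y / p * q ^ k) \<noteq> 0"
    by (rule prod_list_map_nonzero)
  have D: "(1 - q * y * q ^ k) * (\<Prod>p\<leftarrow>ps. 1 - a * q * y / p * q ^ k)
           * (1 - a * q * y / g * q ^ Suc k) * (1 - a * q * y / h * q ^ Suc k) \<noteq> 0"
    using nz nz' by (simp only: mult_eq_0_iff simp_thms)
  have "wp_ratio a y q ps g h (Suc k) = wp_ratio a y q ps g h k * ((1 - a * y * q ^ k) * (\<Prod>p\<leftarrow>ps. 1 - p * y * q ^ k)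
           * (1 - g * y / q * q ^ k) * (1 - h * y / q * q ^ k))
     / ((1 - q * y * q ^ k) * (\<Prod>p\<leftarrow>ps. 1 - a * q * y / p * q ^ k)
           * (1 - a * q * y / g * q ^ Suc k) * (1 - a * q * y / h * q ^ Suc k))"
    unfolding wp_ratio_def qpoch_Suc[of _ _ k] qpoch_Suc[of _ _ "Suc k"] prod_list_map_mult
    by (simp add: mult_ac)
  then show ?thesis
    unfolding nonzero_eq_divide_eq[OF D] x_def
    by (simp only: mult_ac power_Suc times_divide_eq_left times_divide_eq_right)
qed

lemma wp_ratio_LIMSEQ:
  assumes "norm q < 1" and reg: "wp_regular a y q ps g h"
  shows "wp_ratio a y q ps g h \<longlonglongrightarrow> wp_ratio_inf a y q ps g h"
proof -
  have "qpoch_inf (q * y) q \<noteq> 0" "qpoch_inf (a * q * y / g) q \<noteq> 0" "qpoch_inf (a * q * y / h) q \<noteq> 0"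
    "(\<Prod>p\<leftarrow>ps. qpoch_inf (a * q * y / p) q) \<noteq> 0"
    using assms unfolding wp_regular_def by (intro prod_list_map_nonzero qpoch_inf_nonzero; blast)+
  then show ?thesis
    unfolding wp_ratio_def[abs_def] wp_ratio_inf_def
    by (intro tendsto_intros tendsto_prod_list qpoch_LIMSEQ LIMSEQ_Suc[OF qpoch_LIMSEQ] assms(1)) auto
qed

text \<open>Telescoping of \<open>contiguous_key\<close>. The polynomial part of G tends to 1 as x
  tends to 0, so only the limit of the common factor survives at the upper end. At the lower end the
  denominators of \<open>wp_ratio\<close> at k = 0 cancel the last two factors of G and leave the
  factor 1 - y and the factors 1 - a y / p.\<close>

lemma contiguous_sums:
  assumes q: "norm q < 1" and reg: "wp_regular a y q ps g h"
    and len: "length ps = 5" and nz: "0 \<notin> set ps" "a \<noteq> 0" "q \<noteq> 0" "g \<noteq> 0" "h \<noteq> 0"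
    and bal: "prod_list ps * g * h = a^3 * q\<^sup>2"
  defines "x \<equiv> \<lambda>k. y * q ^ k"
  shows "(\<lambda>k. wp_ratio a y q ps g h k * (x k * (1 - a * (x k)\<^sup>2)) *
             (wp_diff a q ps g h (x k) - wp_diff a q ps h g (x k)
              + (g - h) * (\<Prod>p\<leftarrow>ps. 1 - p) * wp_coeff a q g h (x k)))
         sums ((1 - a * q / h) * (1 - a * q / g) * (g - h)
               * (wp_ratio_inf a y q ps g h - (1 - y) * (\<Prod>p\<leftarrow>ps. 1 - a * y / p)))"
    (is "?f sums (?K * _)")
proof -
  define G where "G = (\<lambda>k. ?K * (wp_ratio a y q ps g h k *
     ((1 - x k) * (\<Prod>p\<leftarrow>ps. 1 - a * x k / p) * (1 - a * q * x k / g) * (1 - a * q * x k / h))))"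
  have x_lim: "x \<longlonglongrightarrow> 0"
    unfolding x_def using tendsto_mult_right_zero[OF LIMSEQ_power_zero[OF q]] by simp
  have "G \<longlonglongrightarrow> ?K * (wp_ratio_inf a y q ps g h *
     ((1 - 0) * (\<Prod>p\<leftarrow>ps. 1 - a * 0 / p) * (1 - a * q * 0 / g) * (1 - a * q * 0 / h)))"
    unfolding G_def using nz
    by (intro tendsto_intros tendsto_prod_list wp_ratio_LIMSEQ[OF q reg] x_lim) auto
  then have lim: "G \<longlonglongrightarrow> ?K * wp_ratio_inf a y q ps g h"
    by (simp add: map_replicate_const)
  have "?f k = G (Suc k) - G k" for k
  proof -
    have "x (Suc k) = q * x k"
      by (simp add: x_def)
    then have "G (Suc k) = ?K * (wp_ratio a y q ps g h (Suc k) * ((1 - q * x k) * (\<Prod>p\<leftarrow>ps. 1 - a * q * x k / p)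
           * (1 - a * q * x (Suc k) / g) * (1 - a * q * x (Suc k) / h)))"
      unfolding G_def by (simp add: mult.assoc)
    also have "\<dots> = ?K * (wp_ratio a y q ps g h k * ((1 - a * x k) * (\<Prod>p\<leftarrow>ps. 1 - p * x k)
           * (1 - g * x k / q) * (1 - h * x k / q)))"
      unfolding x_def wp_ratio_Suc[OF reg] ..
    finally have "G (Suc k) - G k = wp_ratio a y q ps g h k * (?K * (
        ((1 - a * x k) * (\<Prod>p\<leftarrow>ps. 1 - p * x k) * (1 - g * x k / q) * (1 - h * x k / q)) -
        ((1 - x k) * (\<Prod>p\<leftarrow>ps. 1 - a * x k / p) * (1 - a * q * x k / g) * (1 - a * q * x k / h))))"
      unfolding G_def by (simp only: right_diff_distrib mult_ac)
    then show ?thesis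
      unfolding contiguous_key[OF len nz bal] by (simp only: mult_ac)
  qed
  then have "?f sums (?K * wp_ratio_inf a y q ps g h - G 0)"
    using telescope_sums[OF lim] by simp
  moreover have "G 0 = ?K * ((1 - y) * (\<Prod>p\<leftarrow>ps. 1 - a * y / p))"
  proof -
    have "qpoch (a * q * y / g) q 1 \<noteq> 0" "qpoch (a * q * y / h) q 1 \<noteq> 0"
      using reg unfolding wp_regular_def by blast+
    then show ?thesis
      unfolding G_def wp_ratio_def x_def by (simp add: qpoch_Suc map_replicate_const)
  qed
  ultimately show ?thesis
    by (simp only: right_diff_distrib)
qed

subsection \<open>Contiguous relation on a single grid\<close>

text \<open>
  For \<open>y = 1\<close> this is the summand of the first series, for \<open>y = p / a\<close> that of the second one,
  both without the factor \<open>1 / (1 - a y\<^sup>2)\<close>.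
\<close>
definition vwp_term :: "complex \<Rightarrow> complex \<Rightarrow> complex \<Rightarrow> complex list \<Rightarrow> complex \<Rightarrow> complex \<Rightarrow> nat \<Rightarrow> complex" where
  "vwp_term a y q ps g h k = (1 - a * (y * q ^ k)\<^sup>2) * q ^ k
     * ((qpoch (a * y) q k * (\<Prod>p\<leftarrow>ps. qpoch (p * y) q k) * qpoch (g * y) q k * qpoch (h * y) q k)
        / (qpoch (q * y) q k * (\<Prod>p\<leftarrow>ps. qpoch (a * q * y / p) q k)
           * qpoch (a * q * y / g) q k * qpoch (a * q * y / h) q k))"

text \<open>The coefficient in the theorem without (1 - h)(1 - a / h). These two factors are kept
  apart because they enter the ratio of the weights in \<open>shift_diff\<close>.\<close>

definition shift_coeff :: "complex \<Rightarrow> complex \<Rightarrow> complex list \<Rightarrow> complex \<Rightarrow> complex \<Rightarrow> complex" where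
  "shift_coeff a q ps g h = g * (1 - a * q / h) * (\<Prod>p\<leftarrow>ps. 1 - a * q / (g * p)) / (1 - h * q / g)"

lemma wp_regular_commute: "wp_regular a y q ps g h \<longleftrightarrow> wp_regular a y q ps h g"
  by (auto simp: wp_regular_def)

lemma vwp_term_commute: "vwp_term a y q ps g h k = vwp_term a y q ps h g k"
  by (simp add: vwp_term_def mult_ac)

text \<open>Without the factor \<open>q ^ k\<close> the summand converges and is therefore bounded,
  so a geometric series dominates.\<close>

lemma vwp_term_summable:
  assumes "norm q < 1" and reg: "wp_regular a y q ps g h"
  shows "summable (vwp_term a y q ps g h)"
proof -
  define t where "t = (\<lambda>k. (1 - a * (y * q ^ k)\<^sup>2) *
     ((qpoch (a * y) q k * (\<Prod>p\<leftarrow>ps. qpoch (p * y) q k) * qpoch (g * y) q k * qpoch (h * y) q k)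
        / (qpoch (q * y) q k * (\<Prod>p\<leftarrow>ps. qpoch (a * q * y / p) q k)
           * qpoch (a * q * y / g) q k * qpoch (a * q * y / h) q k)))"
  have nz: "qpoch_inf (q * y) q \<noteq> 0" "qpoch_inf (a * q * y / g) q \<noteq> 0" "qpoch_inf (a * q * y / h) q \<noteq> 0"
    "(\<Prod>p\<leftarrow>ps. qpoch_inf (a * q * y / p) q) \<noteq> 0"
    using assms unfolding wp_regular_def by (intro prod_list_map_nonzero qpoch_inf_nonzero; blast)+
  have "Bseq t"
  proof (rule convergent_imp_Bseq, rule convergentI)
    show "t \<longlonglongrightarrow> (1 - a * (y * 0)\<^sup>2) *
     ((qpoch_inf (a * y) q * (\<Prod>p\<leftarrow>ps. qpoch_inf (p * y) q) * qpoch_inf (g * y) q * qpoch_inf (h * y) q)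
        / (qpoch_inf (q * y) q * (\<Prod>p\<leftarrow>ps. qpoch_inf (a * q * y / p) q)
           * qpoch_inf (a * q * y / g) q * qpoch_inf (a * q * y / h) q))"
      unfolding t_def using nz
      by (intro tendsto_intros tendsto_prod_list qpoch_LIMSEQ LIMSEQ_power_zero assms(1)) auto
  qed
  then obtain B where B: "\<And>k. norm (t k) \<le> B"
    by (rule BseqE) blast
  have "summable (\<lambda>k. B * norm q ^ k)"
    using assms(1) by (intro summable_mult summable_geometric) simp
  then show ?thesis
  proof (rule summable_comparison_test')
    fix k :: nat
    have "vwp_term a y q ps g h k = t k * q ^ k"
      by (simp add: vwp_term_def t_def)
    then show "norm (vwp_term a y q ps g h k) \<le> B * norm q ^ k"
      using B by (simp add: norm_mult norm_power mult_right_mono)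
  qed
qed

text \<open>
  Replacing only \<open>g\<close> by \<open>g / q\<close> in the numerators keeps the formulas valid when \<open>1 - h y / q = 0\<close>,
  which is not excluded for \<open>y = g / a\<close>.
\<close>
definition wp_half :: "complex \<Rightarrow> complex \<Rightarrow> complex \<Rightarrow> complex list \<Rightarrow> complex \<Rightarrow> complex \<Rightarrow> nat \<Rightarrow> complex" where
  "wp_half a y q ps g h k =
     (qpoch (a * y) q k * (\<Prod>p\<leftarrow>ps. qpoch (p * y) q k) * qpoch (g * y / q) q k * qpoch (h * y) q k)
     / (qpoch (q * y) q k * (\<Prod>p\<leftarrow>ps. qpoch (a * q * y / p) q k)
        * qpoch (a * q * y / g) q (Suc k) * qpoch (a * q * y / h) q k)"

text \<open>\<open>qpoch_shift\<close> trades the step from h y / q to h y for a single factor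
  depending on k. The factor 1 - h y / q stays on the left, since dividing by it would lose the case
  in which it is 0.\<close>

lemma wp_half_ratio:
  assumes "q \<noteq> 0" and reg: "wp_regular a y q ps g h"
  defines "x \<equiv> \<lambda>k. y * q ^ k"
  shows "(1 - h * y / q) * wp_half a y q ps g h k
    = wp_ratio a y q ps g h k * ((1 - h * x k / q) * (1 - a * q * x k / h))"
proof -
  have n: "(1 - h * y / q) * qpoch (h * y) q k = qpoch (h * y / q) q k * (1 - h * x k / q)"
    using qpoch_shift[of "h * y / q" q k] assms(1) by (simp add: x_def)
  have d: "qpoch (a * q * y / h) q (Suc k) = qpoch (a * q * y / h) q k * (1 - a * q * x k / h)"
    by (simp add: x_def qpoch_Suc)
  have "qpoch (a * q * y / h) q (Suc k) \<noteq> 0"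
    using reg unfolding wp_regular_def by blast
  then have nz: "1 - a * q * x k / h \<noteq> 0"
    unfolding d by auto
  have frac: "w * (z * m / (e * f)) = z * m' / (e * (f * c)) * (b * c)"
    if "w * m = m' * b" "c \<noteq> 0" for w z m e f m' b c :: complex
  proof -
    have "w * (z * m / (e * f)) = z * (w * m) / (e * f)"
      by simp
    then show ?thesis
      unfolding that(1) using that(2) by (simp add: mult_ac)
  qed
  show ?thesis
    unfolding wp_half_def wp_ratio_def d by (rule frac[OF n nz])
qed

lemma vwp_term_half:
  assumes "q \<noteq> 0" and reg: "wp_regular a y q ps g h"
  defines "x \<equiv> \<lambda>k. y * q ^ k"
  shows "(1 - g * y / q) * vwp_term a y q ps g h k
    = wp_half a y q ps g h k * ((1 - a * (x k)\<^sup>2) * q ^ k) * ((1 - g * x k / q) * (1 - a * q * x k / g))"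
proof -
  have x: "y * q ^ k = x k"
    by (simp add: x_def)
  have n: "(1 - g * y / q) * qpoch (g * y) q k = qpoch (g * y / q) q k * (1 - g * x k / q)"
    using qpoch_shift[of "g * y / q" q k] assms(1) by (simp add: x_def)
  have d: "qpoch (a * q * y / g) q (Suc k) = qpoch (a * q * y / g) q k * (1 - a * q * x k / g)"
    by (simp add: x_def qpoch_Suc)
  have "qpoch (a * q * y / g) q (Suc k) \<noteq> 0"
    using reg unfolding wp_regular_def by blast
  then have nz: "1 - a * q * x k / g \<noteq> 0"
    unfolding d by auto
  have frac: "w * (z * (u * m * v / (e * f * t))) = u * m' * v / (e * (f * c) * t) * z * (b * c)"
    if "w * m = m' * b" "c \<noteq> 0" for w z u m v e f t m' b c :: complex
  proof -
    have "w * (z * (u * m * v / (e * f * t))) = z * (u * (w * m) * v) / (e * f * t)"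
      by simp
    then show ?thesis
      unfolding that(1) using that(2) by (simp add: mult_ac)
  qed
  show ?thesis
    unfolding vwp_term_def wp_half_def d x by (rule frac[OF n nz])
qed

lemma vwp_term_eq:
  assumes "q \<noteq> 0" and reg: "wp_regular a y q ps g h"
  defines "x \<equiv> \<lambda>k. y * q ^ k"
  shows "(1 - g * y / q) * (1 - h * y / q) * vwp_term a y q ps g h k
    = wp_ratio a y q ps g h k * ((1 - a * (x k)\<^sup>2) * q ^ k) * wp_coeff a q g h (x k)"
proof -
  have "(1 - g * y / q) * (1 - h * y / q) * vwp_term a y q ps g h k
      = (1 - h * y / q) * wp_half a y q ps g h k
          * ((1 - a * (x k)\<^sup>2) * q ^ k) * ((1 - g * x k / q) * (1 - a * q * x k / g))"
    using vwp_term_half[OF assms(1) reg, of k] by (simp add: x_def)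
  then show ?thesis
    unfolding wp_half_ratio[OF assms(1) reg] wp_coeff_def by (simp add: x_def mult_ac)
qed

lemma vwp_term_half_shift:
  assumes "q \<noteq> 0" and reg: "wp_regular a y q ps g h" and reg': "wp_regular a y q ps (g / q) (h * q)"
  defines "x \<equiv> \<lambda>k. y * q ^ k"
  shows "(1 - h * y) * (1 - a * y / h) * vwp_term a y q ps (g / q) (h * q) k
    = (1 - a * q * y / g) * ((1 - h * x k) * (1 - a * x k / h))
      * (wp_half a y q ps g h k * ((1 - a * (x k)\<^sup>2) * q ^ k))"
proof -
  have x: "y * q ^ k = x k"
    by (simp add: x_def)
  have n: "(1 - h * y) * qpoch (h * q * y) q k = qpoch (h * y) q k * (1 - h * x k)"
    using qpoch_shift[of "h * y" q k] by (simp add: x_def mult_ac)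
  have d1: "qpoch (a * q * y / g) q (Suc k) = (1 - a * q * y / g) * qpoch (a * q * y / (g / q)) q k"
    by (simp add: qpoch_Suc_shift mult_ac)
  have d2: "(1 - a * y / h) * qpoch (a * q * y / h) q k = qpoch (a * q * y / (h * q)) q k * (1 - a * x k / h)"
    using qpoch_shift[of "a * y / h" q k] assms(1) by (simp add: x_def mult_ac)
  have "qpoch (a * q * y / g) q (Suc k) \<noteq> 0" "qpoch (a * q * y / h) q k \<noteq> 0"
       "qpoch (a * q * y / (h * q)) q k \<noteq> 0"
    using reg reg' unfolding wp_regular_def by blast+
  then have nz: "1 - a * q * y / g \<noteq> 0" "qpoch (a * q * y / h) q k \<noteq> 0" "qpoch (a * q * y / (h * q)) q k \<noteq> 0"
    unfolding d1 by auto
  have D: "(1 - a * y / h) / qpoch (a * q * y / (h * q)) q k = (1 - a * x k / h) / qpoch (a * q * y / h) q k"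
    unfolding frac_eq_eq[OF nz(3,2)] using d2 by (simp only: mult.commute)
  have frac: "u * v * (Z * (p * m / (d * e * f))) = l * (r * b) * (p * m' / (d * (l * e) * f') * Z)"
    if "u * m = m' * r" "v / f = b / f'" "l \<noteq> 0" for u v Z p m d e f l r b m' f' :: complex
  proof -
    have "u * v * (Z * (p * m / (d * e * f))) = (u * m) * (v / f) * (Z * p) / (d * e)"
      by (simp add: mult_ac)
    then show ?thesis
      unfolding that(1,2) using that(3) by (simp add: mult_ac)
  qed
  have g: "g / q * y = g * y / q"
    by simp
  show ?thesis
    unfolding vwp_term_def wp_half_def d1 g x
    by (rule frac[OF n D nz(1)])
qed

text \<open>The two products in the bracket are quadratic in x and agree at x = 1 and at x = 1 / a,
  so their difference is a constant times (1 - x)(1 - a x). The constant, read off at x = 0,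
  contains g / q - h, which cancels the denominator 1 - h q / g of \<open>shift_coeff\<close>. In
  the proof u is g / q and w is a q / (g h), so that h u w = a.\<close>

lemma shift_coeff_identity:
  assumes "q \<noteq> 0" "g \<noteq> 0" "h \<noteq> 0" "1 - h * q / g \<noteq> 0"
  shows "shift_coeff a q ps g h * ((1 - g / q) * (1 - a * q / g) * ((1 - h * x) * (1 - a * x / h))
      - (1 - h) * (1 - a / h) * ((1 - g * x / q) * (1 - a * q * x / g)))
    = (1 - a * q / (g * h))
      * - (g\<^sup>2 / q * (1 - a * q / h) * (\<Prod>p\<leftarrow>ps. 1 - a * q / (g * p)) * (1 - x) * (1 - a * x))"
proof -
  have id: "(1 - g / q) * (1 - a * q / g) * ((1 - h * x) * (1 - a * x / h))
      - (1 - h) * (1 - a / h) * ((1 - g * x / q) * (1 - a * q * x / g))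
    = - (g / q * (1 - h * q / g) * (1 - a * q / (g * h)) * ((1 - x) * (1 - a * x)))"
  proof -
    have expand: "(1 - u) * (1 - h * w) * ((1 - h * x) * (1 - u * w * x)) - (1 - h) * (1 - u * w) * ((1 - u * x) * (1 - h * w * x))
      = - ((u - h) * (1 - w) * ((1 - x) * (1 - h * u * w * x)))" for u w
      by algebra
    have coeffs: "g / q * (a * q / (g * h)) = a / h" "h * (a * q / (g * h)) = a * q / g"
      "h * (g / q) * (a * q / (g * h)) = a" "g / q * (1 - h * q / g) = g / q - h"
      using assms(1-3) by (simp_all add: right_diff_distrib)
    have args: "g * x / q = g / q * x" "a * x / h = a / h * x" "a * q * x / g = a * q / g * x"
      by simp_all
    show ?thesis
      using expand[of "g / q" "a * q / (g * h)"] unfolding args coeffs .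
  qed
  have cancel: "g * w1 * w2 / d * - (g / q * d * w3 * (w4 * w5)) = w3 * - (g\<^sup>2 / q * w1 * w2 * w4 * w5)"
    if "d \<noteq> 0" for w1 w2 w3 w4 w5 d
    using that by (simp add: power2_eq_square mult_ac)
  show ?thesis
    unfolding id shift_coeff_def by (rule cancel[OF assms(4)])
qed

text \<open>\<open>n0\<close> and \<open>n1\<close> are the weights with which the unshifted and the
  shifted series enter the relation; their ratio is prescribed with cleared denominators. The number
  \<open>v\<close> stands for (1 - a q / (g h)) n / (1 - h y / q). The equation \<open>nu\<close>
  can be met even if that denominator is 0, provided that its left-hand side vanishes as
  well.\<close>

lemma shift_diff:
  assumes nz: "q \<noteq> 0" "g \<noteq> 0" "h \<noteq> 0" "1 - h * q / g \<noteq> 0"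
    and reg: "wp_regular a y q ps g h" and reg': "wp_regular a y q ps (g / q) (h * q)"
    and n0: "n0 = n * (1 - g * y / q)"
    and n1: "(1 - h) * (1 - a / h) * n1 * (1 - a * q * y / g)
      = (1 - g / q) * (1 - a * q / g) * ((1 - h * y) * (1 - a * y / h)) * n"
    and nu: "(1 - a * q / (g * h)) * n = v * (1 - h * y / q)"
  defines "x \<equiv> \<lambda>k. y * q ^ k"
  shows "(1 - h) * (1 - a / h) * shift_coeff a q ps g h
        * (n1 * vwp_term a y q ps (g / q) (h * q) k - n0 * vwp_term a y q ps g h k)
    = v * (wp_ratio a y q ps g h k * ((1 - a * (x k)\<^sup>2) * q ^ k)) * wp_diff a q ps g h (x k)"
proof -
  let ?r = "wp_half a y q ps g h k * ((1 - a * (x k)\<^sup>2) * q ^ k)"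
  have T: "n0 * vwp_term a y q ps g h k = n * (?r * ((1 - g * x k / q) * (1 - a * q * x k / g)))"
    using vwp_term_half[OF nz(1) reg, of k] by (simp add: n0 x_def mult_ac)
  have "qpoch (a * q * y / g) q 1 \<noteq> 0"
    using reg unfolding wp_regular_def by blast
  then have D: "1 - a * q * y / g \<noteq> 0"
    by (simp add: qpoch_Suc)
  have "(1 - a * q * y / g) * ((1 - h) * (1 - a / h) * (n1 * vwp_term a y q ps (g / q) (h * q) k))
    = ((1 - h) * (1 - a / h) * n1 * (1 - a * q * y / g)) * vwp_term a y q ps (g / q) (h * q) k"
    by (simp only: mult_ac)
  also have "\<dots> = (1 - g / q) * (1 - a * q / g) * n *
      ((1 - h * y) * (1 - a * y / h) * vwp_term a y q ps (g / q) (h * q) k)"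
    unfolding n1 by (simp only: mult_ac)
  also have "\<dots> = (1 - a * q * y / g) * ((1 - g / q) * (1 - a * q / g) * ((1 - h * x k) * (1 - a * x k / h)) * (n * ?r))"
    unfolding vwp_term_half_shift[OF nz(1) reg reg'] x_def by (simp only: mult_ac)
  finally have T1: "(1 - h) * (1 - a / h) * (n1 * vwp_term a y q ps (g / q) (h * q) k)
     = (1 - g / q) * (1 - a * q / g) * ((1 - h * x k) * (1 - a * x k / h)) * (n * ?r)"
    using D mult_left_cancel by blast
  define t where "t = (1 - g / q) * (1 - a * q / g) * ((1 - h * x k) * (1 - a * x k / h))
      - (1 - h) * (1 - a / h) * ((1 - g * x k / q) * (1 - a * q * x k / g))"
  define s where "s = g\<^sup>2 / q * (1 - a * q / h) * (\<Prod>p\<leftarrow>ps. 1 - a * q / (g * p)) * (1 - x k) * (1 - a * x k)"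
  have t: "shift_coeff a q ps g h * t = (1 - a * q / (g * h)) * - s"
    unfolding t_def s_def by (rule shift_coeff_identity[OF nz])
  have "(1 - h) * (1 - a / h) * shift_coeff a q ps g h
        * (n1 * vwp_term a y q ps (g / q) (h * q) k - n0 * vwp_term a y q ps g h k)
    = shift_coeff a q ps g h * ((1 - h) * (1 - a / h) * (n1 * vwp_term a y q ps (g / q) (h * q) k)
         - (1 - h) * (1 - a / h) * (n0 * vwp_term a y q ps g h k))"
    by (simp add: algebra_simps)
  also have "\<dots> = n * ?r * (shift_coeff a q ps g h * t)"
  proof -
    have "s * (u * (n * r) - z * (n * (r * w))) = n * r * (s * (u - z * w))" for s u r z w :: complex
      by (simp add: algebra_simps)
    then show ?thesis
      unfolding T1 T t_def .
  qed
  also have "\<dots> = ((1 - a * q / (g * h)) * n) * ?r * - s"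
    unfolding t by (simp only: mult_ac)
  also have "\<dots> = v * ((1 - h * y / q) * wp_half a y q ps g h k) * ((1 - a * (x k)\<^sup>2) * q ^ k) * - s"
    unfolding nu by (simp only: mult_ac)
  also have "\<dots> = v * (wp_ratio a y q ps g h k * ((1 - a * (x k)\<^sup>2) * q ^ k))
      * - (s * (1 - h * x k / q) * (1 - a * q * x k / h))"
    unfolding wp_half_ratio[OF nz(1) reg] by (simp add: x_def mult_ac)
  finally show ?thesis
    unfolding s_def wp_diff_def .
qed

text \<open>Passes from the grid starting at y to the one starting at y q, in order to split off
  initial terms.\<close>

lemma vwp_term_Suc:
  "vwp_term a y q ps g h (Suc k) =
     q * ((1 - a * y) * (\<Prod>p\<leftarrow>ps. 1 - p * y) * (1 - g * y) * (1 - h * y)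
      / ((1 - q * y) * (\<Prod>p\<leftarrow>ps. 1 - a * q * y / p) * (1 - a * q * y / g) * (1 - a * q * y / h)))
     * vwp_term a (y * q) q ps g h k"
proof -
  have arg: "p * y * q = p * (y * q)" "q * y * q = q * (y * q)" "a * q * y / p * q = a * q * (y * q) / p"
    "y * q ^ Suc k = y * q * q ^ k" for p
    by simp_all
  show ?thesis
    unfolding vwp_term_def qpoch_Suc_shift prod_list_map_mult arg
    by (simp only: times_divide_times_eq times_divide_eq_left times_divide_eq_right divide_divide_eq_left mult_ac power_Suc)
qed

text \<open>The weights are left open because the relation has to serve the first series as well as
  the second one with its prefactor. The factor 1 - a q / (g h), which \<open>shift_diff\<close>
  extracts from both differences, is also put in front of the third term; then
  \<open>contiguous_sums\<close> applies to the whole. The leading \<open>y\<close> arises because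
  the summands carry \<open>q ^ k\<close> where the telescoping sum has x = y q^k.\<close>

lemma contiguous_grid:
  assumes q: "norm q < 1" and y: "y \<noteq> 0"
    and len: "length ps = 5" and nz: "0 \<notin> set ps" "a \<noteq> 0" "q \<noteq> 0" "g \<noteq> 0" "h \<noteq> 0"
    and bal: "prod_list ps * g * h = a^3 * q\<^sup>2"
    and ne: "1 - h * q / g \<noteq> 0" "1 - g * q / h \<noteq> 0"
    and reg: "wp_regular a y q ps g h" "wp_regular a y q ps (g / q) (h * q)" "wp_regular a y q ps (g * q) (h / q)"
    and n0: "n0 = n * ((1 - g * y / q) * (1 - h * y / q))"
    and n1: "(1 - h) * (1 - a / h) * n1 * (1 - a * q * y / g)
      = (1 - g / q) * (1 - a * q / g) * ((1 - h * y) * (1 - a * y / h)) * (n * (1 - h * y / q))"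
    and n2: "(1 - g) * (1 - a / g) * n2 * (1 - a * q * y / h)
      = (1 - h / q) * (1 - a * q / h) * ((1 - g * y) * (1 - a * y / g)) * (n * (1 - g * y / q))"
    and S0: "vwp_term a y q ps g h sums S0"
    and S1: "vwp_term a y q ps (g / q) (h * q) sums S1"
    and S2: "vwp_term a y q ps (g * q) (h / q) sums S2"
  shows "y * ((1 - h) * (1 - a / h) * shift_coeff a q ps g h * (n1 * S1 - n0 * S0)
         - (1 - g) * (1 - a / g) * shift_coeff a q ps h g * (n2 * S2 - n0 * S0)
         + (1 - a * q / (g * h)) * (g - h) * (\<Prod>p\<leftarrow>ps. 1 - p) * (n0 * S0))
    = (1 - a * q / (g * h)) * n * ((1 - a * q / h) * (1 - a * q / g) * (g - h)
        * (wp_ratio_inf a y q ps g h - (1 - y) * (\<Prod>p\<leftarrow>ps. 1 - a * y / p)))"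
proof -
  define x where "x = (\<lambda>k. y * q ^ k)"
  define K where "K = 1 - a * q / (g * h)"
  define r where "r = (\<lambda>k. wp_ratio a y q ps g h k * ((1 - a * (x k)\<^sup>2) * q ^ k))"
  have 1: "(1 - h) * (1 - a / h) * shift_coeff a q ps g h
        * (n1 * vwp_term a y q ps (g / q) (h * q) k - n0 * vwp_term a y q ps g h k)
    = K * n * r k * wp_diff a q ps g h (x k)" for k
    unfolding r_def x_def
    by (rule shift_diff[where n = "n * (1 - h * y / q)", OF nz(3-5) ne(1) reg(1,2) _ n1]) (simp_all add: n0 K_def)
  have 2: "(1 - g) * (1 - a / g) * shift_coeff a q ps h g
        * (n2 * vwp_term a y q ps (g * q) (h / q) k - n0 * vwp_term a y q ps g h k)
    = K * n * r k * wp_diff a q ps h g (x k)" for k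
    unfolding r_def x_def vwp_term_commute[of a y q ps g] vwp_term_commute[of a y q ps "g * q"] wp_ratio_commute[of a y q ps g]
    by (rule shift_diff[where n = "n * (1 - g * y / q)", OF nz(3,5,4) ne(2) _ _ _ n2])
       (use reg wp_regular_commute in \<open>simp_all add: n0 K_def mult.commute[of h g]\<close>)
  have 3: "n0 * vwp_term a y q ps g h k = n * r k * wp_coeff a q g h (x k)" for k
    using vwp_term_eq[OF nz(3) reg(1), of k] unfolding n0 r_def x_def by (simp add: mult_ac)
  let ?A = "(1 - h) * (1 - a / h) * shift_coeff a q ps g h" and ?B = "(1 - g) * (1 - a / g) * shift_coeff a q ps h g"
    and ?C = "K * (g - h) * (\<Prod>p\<leftarrow>ps. 1 - p)"
  have "(\<lambda>k. y * (?A * (n1 * vwp_term a y q ps (g / q) (h * q) k - n0 * vwp_term a y q ps g h k)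
       - ?B * (n2 * vwp_term a y q ps (g * q) (h / q) k - n0 * vwp_term a y q ps g h k)
       + ?C * (n0 * vwp_term a y q ps g h k)))
    sums (y * (?A * (n1 * S1 - n0 * S0) - ?B * (n2 * S2 - n0 * S0) + ?C * (n0 * S0)))"
    by (intro sums_mult sums_diff sums_add S0 S1 S2)
  moreover have "y * (?A * (n1 * vwp_term a y q ps (g / q) (h * q) k - n0 * vwp_term a y q ps g h k)
       - ?B * (n2 * vwp_term a y q ps (g * q) (h / q) k - n0 * vwp_term a y q ps g h k)
       + ?C * (n0 * vwp_term a y q ps g h k))
     = K * n * (wp_ratio a y q ps g h k * (x k * (1 - a * (x k)\<^sup>2)) *
             (wp_diff a q ps g h (x k) - wp_diff a q ps h g (x k)
              + (g - h) * (\<Prod>p\<leftarrow>ps. 1 - p) * wp_coeff a q g h (x k)))" for k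
  proof -
    have "y * (K * n * r k * d - K * n * r k * d' + K * u * v * (n * r k * w)) = K * n * (y * r k * (d - d' + u * v * w))"
      for d d' u v w
      by (simp add: algebra_simps)
    moreover have "y * r k = wp_ratio a y q ps g h k * (x k * (1 - a * (x k)\<^sup>2))"
      by (simp add: r_def x_def)
    ultimately show ?thesis
      unfolding 1 2 unfolding 3 by simp
  qed
  ultimately have "(\<lambda>k. K * n * (wp_ratio a y q ps g h k * (x k * (1 - a * (x k)\<^sup>2)) *
             (wp_diff a q ps g h (x k) - wp_diff a q ps h g (x k)
              + (g - h) * (\<Prod>p\<leftarrow>ps. 1 - p) * wp_coeff a q g h (x k))))
    sums (y * (?A * (n1 * S1 - n0 * S0) - ?B * (n2 * S2 - n0 * S0) + ?C * (n0 * S0)))"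
    by simp
  moreover have "(\<lambda>k. K * n * (wp_ratio a y q ps g h k * (x k * (1 - a * (x k)\<^sup>2)) *
             (wp_diff a q ps g h (x k) - wp_diff a q ps h g (x k)
              + (g - h) * (\<Prod>p\<leftarrow>ps. 1 - p) * wp_coeff a q g h (x k))))
    sums (K * n * ((1 - a * q / h) * (1 - a * q / g) * (g - h)
        * (wp_ratio_inf a y q ps g h - (1 - y) * (\<Prod>p\<leftarrow>ps. 1 - a * y / p))))"
    unfolding x_def by (intro sums_mult contiguous_sums q reg(1) len nz bal)
  ultimately show ?thesis
    unfolding K_def by (rule sums_unique2)
qed

subsection \<open>The two series of \<open>\<Phi>\<close>\<close>

lemma prod_list_others:
  fixes f :: "'a \<Rightarrow> 'b :: comm_monoid_mult"
  assumes "i < length ps"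
  shows "(\<Prod>p\<leftarrow>ps. f p) = f (ps ! i) * (\<Prod>p\<leftarrow>others i ps. f p)"
proof -
  have "(\<Prod>p\<leftarrow>ps. f p) = (\<Prod>p\<leftarrow>take i ps @ ps ! i # drop (Suc i) ps. f p)"
    using id_take_nth_drop[OF assms] by simp
  then show ?thesis
    by (simp add: others_def mult_ac)
qed

lemma set_others:
  assumes "i < length ps"
  shows "set ps = insert (ps ! i) (set (others i ps))"
proof -
  have "set ps = set (take i ps @ ps ! i # drop (Suc i) ps)"
    using id_take_nth_drop[OF assms] by simp
  then show ?thesis
    by (simp add: others_def)
qed

text \<open>For the seven parameters this is the limit of the summand of the first series without
  its factor \<open>q ^ k\<close>; the quotient of (a)_k by 1 - a tends to the infinite product with
  base point a q.\<close>

definition wp_limit :: "complex \<Rightarrow> complex \<Rightarrow> complex list \<Rightarrow> complex" where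
  "wp_limit a q ms = qpoch_inf (a * q) q * (\<Prod>p\<leftarrow>ms. qpoch_inf p q) / (qpoch_inf q q * (\<Prod>p\<leftarrow>ms. qpoch_inf (a * q / p) q))"

lemma qpoch_regular_shift:
  assumes "\<And>k. qpoch x q k \<noteq> 0"
  shows "qpoch (x * q) q k \<noteq> 0"
  using assms[of "Suc k"] by (simp add: qpoch_Suc_shift)

lemma wp_regular_shift:
  assumes "wp_regular a y q ps g h"
  shows "wp_regular a (y * q) q ps g h"
proof -
  have "qpoch (a * q * (y * q) / p) q k \<noteq> 0" if "\<forall>k. qpoch (a * q * y / p) q k \<noteq> 0" for p k
    using qpoch_regular_shift[of "a * q * y / p" q k] that by (simp add: mult_ac)
  moreover have "qpoch (q * (y * q)) q k \<noteq> 0" if "\<forall>k. qpoch (q * y) q k \<noteq> 0" for k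
    using qpoch_regular_shift[of "q * y" q k] that by (simp add: mult_ac)
  ultimately show ?thesis
    using assms unfolding wp_regular_def by meson
qed

lemma W10_9_eq:
  assumes "vwp_term a 1 q ps g h sums S"
  shows "W10_9 a (ps @ [g, h]) q = S / (1 - a)"
proof -
  have "W10_9 a (ps @ [g, h]) q = (\<Sum>k. vwp_term a 1 q ps g h k / (1 - a))"
    unfolding W10_9_def vwp_term_def by (simp add: mult_ac power_mult power2_eq_square power_add mult_2)
  also have "\<dots> = S / (1 - a)"
    by (intro sums_unique[symmetric] sums_divide assms)
  finally show ?thesis .
qed

text \<open>On the grid starting at y = p / a the parameters a and p exchange roles: a y = p is an
  ordinary parameter of the second series, and p y = p^2 / a is its leading one. Dually, a q y / p
  equals q, and q y is the denominator parameter that belongs to p.\<close>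

lemma W10_9_second_eq:
  fixes a q g h :: complex and ps :: "complex list" and i :: nat
  defines "ms \<equiv> ps @ [g, h]" and "p \<equiv> (ps @ [g, h]) ! i"
  assumes i: "i < length ps + 2" and nz: "a \<noteq> 0" "0 \<notin> set ms"
    and S: "vwp_term a (p / a) q ps g h sums S"
  shows "W10_9 (p\<^sup>2 / a) (p # map (\<lambda>r. p * r / a) (others i ms)) q = S / (1 - a * (p / a)\<^sup>2)"
proof -
  have len: "i < length ms"
    using i by (simp add: ms_def)
  have p: "ms ! i = p" "p \<noteq> 0"
    using nz len nth_mem[OF len] unfolding p_def ms_def by metis+
  have sq: "p\<^sup>2 / a = a * (p / a)\<^sup>2" "p\<^sup>2 / a = p * (p / a)" "p * r / a = r * (p / a)" for r
    using nz by (simp_all add: power2_eq_square)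
  have "(1 - p\<^sup>2 / a * q ^ (2 * k)) / (1 - p\<^sup>2 / a)
      * (qpoch (p\<^sup>2 / a) q k * (\<Prod>r\<leftarrow>p # map (\<lambda>r. p * r / a) (others i ms). qpoch r q k)
         / (qpoch q q k * (\<Prod>r\<leftarrow>p # map (\<lambda>r. p * r / a) (others i ms). qpoch (p\<^sup>2 / a * q / r) q k))) * q ^ k
    = vwp_term a (p / a) q ps g h k / (1 - a * (p / a)\<^sup>2)" for k
  proof -
    have num: "qpoch (a * (p / a)) q k * (\<Prod>r\<leftarrow>ms. qpoch (r * (p / a)) q k)
      = qpoch (p\<^sup>2 / a) q k * (\<Prod>r\<leftarrow>p # map (\<lambda>r. p * r / a) (others i ms). qpoch r q k)"
      using nz unfolding prod_list_others[OF len] p by (simp add: o_def power2_eq_square mult_ac)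
    have den: "qpoch (q * (p / a)) q k * (\<Prod>r\<leftarrow>ms. qpoch (a * q * (p / a) / r) q k)
      = qpoch q q k * (\<Prod>r\<leftarrow>p # map (\<lambda>r. p * r / a) (others i ms). qpoch (p\<^sup>2 / a * q / r) q k)"
    proof -
      have "p\<^sup>2 / a * q / (p * r / a) = a * q * (p / a) / r" "a * q * (p / a) / p = q" "p\<^sup>2 / a * q / p = q * (p / a)" for r
        using nz p by (simp_all add: power2_eq_square)
      then show ?thesis
        unfolding prod_list_others[OF len] p list.map prod_list.Cons map_map o_def by (simp only: mult_ac)
    qed
    have sqk: "p\<^sup>2 / a * q ^ (2 * k) = a * (p / a * q ^ k)\<^sup>2"
      using nz by (simp add: power2_eq_square power_add mult_2)
    have V: "vwp_term a (p / a) q ps g h k = (1 - a * (p / a * q ^ k)\<^sup>2) * q ^ k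
       * ((qpoch (a * (p / a)) q k * (\<Prod>r\<leftarrow>ms. qpoch (r * (p / a)) q k))
        / (qpoch (q * (p / a)) q k * (\<Prod>r\<leftarrow>ms. qpoch (a * q * (p / a) / r) q k)))"
      unfolding vwp_term_def ms_def by (simp add: mult.assoc)
    show ?thesis
      unfolding V num den sqk sq(1)[symmetric] by (simp add: mult_ac)
  qed
  then have "W10_9 (p\<^sup>2 / a) (p # map (\<lambda>r. p * r / a) (others i ms)) q
     = (\<Sum>k. vwp_term a (p / a) q ps g h k / (1 - a * (p / a)\<^sup>2))"
    unfolding W10_9_def by simp
  also have "\<dots> = S / (1 - a * (p / a)\<^sup>2)"
    by (intro sums_unique[symmetric] sums_divide S)
  finally show ?thesis .
qed

section \<open>Contiguous relation for the first series\<close>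

text \<open>Separates the coefficients, which are common to both series, from the series themselves.
  The first series yields an instance with some right-hand side L, the second one an instance with
  -L, and the two are added.\<close>

locale three_term_relation =
  fixes A B C F0 F1 F2 L :: complex
  assumes relation: "A * (F1 - F0) - B * (F2 - F0) + C * F0 = L"
begin

lemma relation_add:
  assumes "three_term_relation A B C G0 G1 G2 (- L)"
  shows "A * (F1 + G1 - (F0 + G0)) - B * (F2 + G2 - (F0 + G0)) + C * (F0 + G0) = 0"
proof -
  have "A * (F1 + G1 - (F0 + G0)) - B * (F2 + G2 - (F0 + G0)) + C * (F0 + G0)
    = (A * (F1 - F0) - B * (F2 - F0) + C * F0) + (A * (G1 - G0) - B * (G2 - G0) + C * G0)"
    by (simp add: algebra_simps)
  then show ?thesis
    unfolding relation three_term_relation.relation[OF assms] by simp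
qed

end

locale contiguous_first_series =
  fixes a q g h :: complex and ps :: "complex list"
  assumes q: "norm q < 1"
    and len: "length ps = 5" and nz: "0 \<notin> set ps" "a \<noteq> 0" "q \<noteq> 0" "g \<noteq> 0" "h \<noteq> 0" "1 - a \<noteq> 0"
    and bal: "prod_list ps * g * h = a^3 * q\<^sup>2"
    and ne: "1 - h * q / g \<noteq> 0" "1 - g * q / h \<noteq> 0"
    and reg: "wp_regular a 1 q ps g h" "wp_regular a 1 q ps (g / q) (h * q)" "wp_regular a 1 q ps (g * q) (h / q)"

sublocale contiguous_first_series \<subseteq> three_term_relation
  "(1 - h) * (1 - a / h) * shift_coeff a q ps g h"
  "(1 - g) * (1 - a / g) * shift_coeff a q ps h g"
  "(1 - a * q / (g * h)) * (g - h) * (\<Prod>p\<leftarrow>ps. 1 - p)"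
  "W10_9 a (ps @ [g, h]) q"
  "W10_9 a (ps @ [g / q, h * q]) q"
  "W10_9 a (ps @ [g * q, h / q]) q"
  "(1 - a * q / (g * h)) * ((1 - a * q / h) * (1 - a * q / g) * (g - h)) * wp_limit a q (ps @ [g, h])"
proof (unfold_locales, goal_cases)
  case 1
  define W0 where "W0 = W10_9 a (ps @ [g, h]) q"
  define W1 where "W1 = W10_9 a (ps @ [g / q, h * q]) q"
  define W2 where "W2 = W10_9 a (ps @ [g * q, h / q]) q"
  have "(1 - h) * (1 - a / h) * shift_coeff a q ps g h * (W1 - W0)
         - (1 - g) * (1 - a / g) * shift_coeff a q ps h g * (W2 - W0)
         + (1 - a * q / (g * h)) * (g - h) * (\<Prod>p\<leftarrow>ps. 1 - p) * W0
    = (1 - a * q / (g * h)) * ((1 - a * q / h) * (1 - a * q / g) * (g - h)) * wp_limit a q (ps @ [g, h])"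
  proof -
    \<comment> \<open>\<open>w\<close> relates term k + 1 on the grid from 1 to term k on the grid
      from q, and \<open>n\<close> is \<open>w\<close> without (1 - g)(1 - h). Starting at y = 1
      would require division by (1 - g / q)(1 - h / q), which is 0 for g = q or h = q; at y = q the
      corresponding factors are those already present in \<open>w\<close>.\<close>
    define w where "w = (\<lambda>g h. q * ((1 - a) * (\<Prod>p\<leftarrow>ps. 1 - p) * (1 - g) * (1 - h)
        / ((1 - q) * (\<Prod>p\<leftarrow>ps. 1 - a * q / p) * (1 - a * q / g) * (1 - a * q / h))))"
    define n where "n = q * ((1 - a) * (\<Prod>p\<leftarrow>ps. 1 - p)
        / ((1 - q) * (\<Prod>p\<leftarrow>ps. 1 - a * q / p) * (1 - a * q / g) * (1 - a * q / h)))"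
    define S where "S = (\<lambda>g h. suminf (vwp_term a q q ps g h))"
    have S: "vwp_term a q q ps g h sums S g h" 
      and W: "(1 - a) * W10_9 a (ps @ [g, h]) q = w g h * S g h + (1 - a)"
      if "wp_regular a 1 q ps g h" for g h
    proof -
      show S: "vwp_term a q q ps g h sums S g h"
        unfolding S_def using wp_regular_shift[OF that] by (intro summable_sums vwp_term_summable q) simp
      have "(\<lambda>k. w g h * vwp_term a q q ps g h k) sums (w g h * S g h)"
        by (intro sums_mult S)
      then have "(\<lambda>k. vwp_term a 1 q ps g h (Suc k)) sums (w g h * S g h)"
        unfolding vwp_term_Suc w_def by simp
      then have "vwp_term a 1 q ps g h sums (w g h * S g h + vwp_term a 1 q ps g h 0)"
        by (rule sums_Suc)
      moreover have "vwp_term a 1 q ps g h 0 = 1 - a"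
        by (simp add: vwp_term_def map_replicate_const)
      ultimately show "(1 - a) * W10_9 a (ps @ [g, h]) q = w g h * S g h + (1 - a)"
        using W10_9_eq nz(6) by (metis nonzero_mult_div_cancel_left times_divide_eq_right)
    qed
    have unit: "1 - x \<noteq> 0" if "\<And>k. qpoch x q k \<noteq> 0" for x
      using that[of 1] by (simp add: qpoch_Suc)
    have d: "1 - q \<noteq> 0" "1 - a * q / g \<noteq> 0" "1 - a * q / h \<noteq> 0" "1 - a * q / (g / q) \<noteq> 0" "1 - a * q / (h * q) \<noteq> 0"
      "1 - a * q / (g * q) \<noteq> 0" "1 - a * q / (h / q) \<noteq> 0"
      and dP: "\<And>p. p \<in> set ps \<Longrightarrow> 1 - a * q / p \<noteq> 0"
      using reg unfolding wp_regular_def mult_1_right by (intro unit; blast)+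
    have dP: "(\<Prod>p\<leftarrow>ps. 1 - a * q / p) \<noteq> 0"
      using dP by (rule prod_list_map_nonzero)
    have grid: "q * ((1 - h) * (1 - a / h) * shift_coeff a q ps g h * (w (g / q) (h * q) * S (g / q) (h * q) - w g h * S g h)
           - (1 - g) * (1 - a / g) * shift_coeff a q ps h g * (w (g * q) (h / q) * S (g * q) (h / q) - w g h * S g h)
           + (1 - a * q / (g * h)) * (g - h) * (\<Prod>p\<leftarrow>ps. 1 - p) * (w g h * S g h))
      = (1 - a * q / (g * h)) * n * ((1 - a * q / h) * (1 - a * q / g) * (g - h)
          * (wp_ratio_inf a q q ps g h - (1 - q) * (\<Prod>p\<leftarrow>ps. 1 - a * q / p)))"
    proof (rule contiguous_grid[OF q nz(3) len nz(1-5) bal ne])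
      show "wp_regular a q q ps g h" "wp_regular a q q ps (g / q) (h * q)" "wp_regular a q q ps (g * q) (h / q)"
        using reg[THEN wp_regular_shift] by simp_all
      show "w g h = n * ((1 - g * q / q) * (1 - h * q / q))"
        using nz unfolding w_def n_def by simp
      have cancel: "h1 * ah * (q * (a1 * P * u * v / (q1 * D * ag * ah))) * ag = u * e * (v * f) * (q * (a1 * P / (q1 * D * e * f)) * h1)"
        if "ah \<noteq> 0" "ag \<noteq> 0" "e \<noteq> 0" "f \<noteq> 0" for h1 ah a1 P u v q1 D ag e f
        using that by (simp add: mult_ac)
      show "(1 - h) * (1 - a / h) * w (g / q) (h * q) * (1 - a * q * q / g)
        = (1 - g / q) * (1 - a * q / g) * ((1 - h * q) * (1 - a * q / h)) * (n * (1 - h * q / q))"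
        using cancel[OF d(5,4,2,3), of "1 - h"] nz unfolding w_def n_def by simp
      have w_comm: "w (g * q) (h / q) = w (h / q) (g * q)"
        by (simp only: w_def mult_ac)
      have n_comm: "n = q * ((1 - a) * (\<Prod>p\<leftarrow>ps. 1 - p)
        / ((1 - q) * (\<Prod>p\<leftarrow>ps. 1 - a * q / p) * (1 - a * q / h) * (1 - a * q / g)))"
        by (simp only: n_def mult_ac)
      show "(1 - g) * (1 - a / g) * w (g * q) (h / q) * (1 - a * q * q / h)
        = (1 - h / q) * (1 - a * q / h) * ((1 - g * q) * (1 - a * q / g)) * (n * (1 - g * q / q))"
        using cancel[OF d(6,7,3,2), of "1 - g"] nz unfolding w_comm unfolding w_def n_comm by simp
    qed (intro S reg)+
    \<comment> \<open>After division by 1 - a the terms split off at x = 1 are all 1, so they cancel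
      in the two differences and survive only in the third term of the relation. There they are
      compensated by the boundary value of the telescoping sum at x = q.\<close>
    have start: "n * ((1 - a * q / h) * (1 - a * q / g) * (g - h) * ((1 - q) * (\<Prod>p\<leftarrow>ps. 1 - a * q / p)))
       = q * ((g - h) * (\<Prod>p\<leftarrow>ps. 1 - p) * (1 - a))"
    proof -
      have "q * (u * P / (v * D * e * f)) * (f * e * c * (v * D)) = q * (c * P * u)"
        if "v \<noteq> 0" "D \<noteq> 0" "e \<noteq> 0" "f \<noteq> 0" for u P v D e f c
        using that by simp
      then show ?thesis
        unfolding n_def using d(1-3) dP by blast
    qed
    have lim: "n * wp_ratio_inf a q q ps g h = q * (1 - a) * wp_limit a q (ps @ [g, h])"
    proof -
      have rec: "qpoch_inf p q = (1 - p) * qpoch_inf (p * q) q" "qpoch_inf (a * q / p) q = (1 - a * q / p) * qpoch_inf (a * q * q / p) q" for p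
        using qpoch_inf_rec[OF q, of p] qpoch_inf_rec[OF q, of "a * q / p"] by simp_all
      have "wp_limit a q (ps @ [g, h]) = qpoch_inf (a * q) q * (\<Prod>p\<leftarrow>ps. (1 - p) * qpoch_inf (p * q) q) * qpoch_inf g q * qpoch_inf h q
         / (((1 - q) * qpoch_inf (q * q) q) * (\<Prod>p\<leftarrow>ps. (1 - a * q / p) * qpoch_inf (a * q * q / p) q)
          * ((1 - a * q / g) * qpoch_inf (a * q * q / g) q) * ((1 - a * q / h) * qpoch_inf (a * q * q / h) q))"
        unfolding rec[symmetric] wp_limit_def by (simp add: mult.assoc)
      then show ?thesis
        using nz(3) unfolding n_def wp_ratio_inf_def prod_list_map_mult by (simp add: mult_ac)
    qed
    have terms: "w g h * S g h = (1 - a) * (W0 - 1)" "w (g / q) (h * q) * S (g / q) (h * q) = (1 - a) * (W1 - 1)"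
      "w (g * q) (h / q) * S (g * q) (h / q) = (1 - a) * (W2 - 1)"
      using W[OF reg(1)] W[OF reg(2)] W[OF reg(3)] unfolding W0_def W1_def W2_def by (simp_all add: right_diff_distrib)
    have "A * (W1 - W0) - B * (W2 - W0) + K * G * P * W0 = K * C * L"
      if "q * (A * (D * (W1 - 1) - D * (W0 - 1)) - B * (D * (W2 - 1) - D * (W0 - 1)) + K * G * P * (D * (W0 - 1)))
          = K * n * (C * (R - E))" "n * (C * E) = q * (G * P * D)" "n * R = q * D * L" "D \<noteq> 0"
      for A B K G P D C E R L
    proof -
      have "K * n * (C * (R - E)) = K * C * (n * R) - K * (n * (C * E))"
        by (simp add: algebra_simps)
      then have "(q * D) * (A * (W1 - W0) - B * (W2 - W0) + K * G * P * W0) = (q * D) * (K * C * L)"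
        using that(1) unfolding that(2,3) by (simp add: algebra_simps)
      then show ?thesis
        using nz(3) that(4) mult_left_cancel[of "q * D"] by simp
    qed
    from this[OF grid[unfolded terms] start lim nz(6)] show ?thesis .
  qed
  then show ?case
    unfolding W0_def W1_def W2_def .
qed

lemmas (in contiguous_first_series) three_term = three_term_relation_axioms

section \<open>Prefactor and regularity of the second series\<close>

definition phi_ratio :: "complex \<Rightarrow> complex \<Rightarrow> complex \<Rightarrow> complex \<Rightarrow> complex" where
  "phi_ratio a q p r = (qpoch_inf r q * qpoch_inf (p * q / r) q) / (qpoch_inf (a * q / r) q * qpoch_inf (p * r / a) q)"

definition phi_factor :: "nat \<Rightarrow> complex \<Rightarrow> complex list \<Rightarrow> complex \<Rightarrow> complex" where
  "phi_factor i a ms q = (let p = ms ! i in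
     (qpoch_inf (a * q) q * qpoch_inf (p / a) q) / (qpoch_inf (p\<^sup>2 * q / a) q * qpoch_inf (a / p) q)
     * (\<Prod>r\<leftarrow>others i ms. phi_ratio a q p r))"

definition phi_second :: "nat \<Rightarrow> complex \<Rightarrow> complex list \<Rightarrow> complex \<Rightarrow> complex" where
  "phi_second i a ms q = (let p = ms ! i in
     phi_factor i a ms q * W10_9 (p\<^sup>2 / a) (p # map (\<lambda>r. p * r / a) (others i ms)) q)"

lemma Phi_eq: "Phi i a ms q = W10_9 a ms q + phi_second i a ms q"
  by (simp add: Phi_def phi_second_def phi_factor_def phi_ratio_def Let_def)

text \<open>Puts regularity into the form needed on the grid from y = p / a. Parameters with the
  value p need their own argument: a q y / p = q leads to (q)_k, which is nonzero because |q| < 1,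
  and p y = p^2 / a is the leading parameter of the second series.\<close>

lemma Phi_regularD:
  assumes q: "norm q < 1" and i: "i < length ms" and reg: "Phi_regular i a ms q"
  defines "y \<equiv> ms ! i / a"
  shows "a \<noteq> 0" "1 - a \<noteq> 0" "0 \<notin> set ms" "y \<noteq> 0" "1 - a * y\<^sup>2 \<noteq> 0"
    "\<And>r k. r \<in> set ms \<Longrightarrow> qpoch (a * q / r) q k \<noteq> 0"
    "\<And>k. qpoch (q * y) q k \<noteq> 0"
    "\<And>r k. r \<in> set ms \<Longrightarrow> qpoch (a * q * y / r) q k \<noteq> 0"
    "\<And>r. r \<in> set ms \<Longrightarrow> qpoch_inf (r * y) q \<noteq> 0"
    "qpoch_inf (a / (ms ! i)) q \<noteq> 0"
proof -
  define p where "p = ms ! i"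
  have p: "p \<in> set ms"
    using i by (simp add: p_def)
  note R = reg[unfolded Phi_regular_def Let_def W10_9_regular_def, folded p_def]
  show a: "a \<noteq> 0" "1 - a \<noteq> 0" and 0: "0 \<notin> set ms"
    using R by auto
  then have p0: "p \<noteq> 0"
    using p by metis
  then show "y \<noteq> 0"
    using a by (simp add: y_def flip: p_def)
  have sq: "a * y\<^sup>2 = p\<^sup>2 / a"
    using a by (simp add: y_def power2_eq_square flip: p_def)
  show ay: "1 - a * y\<^sup>2 \<noteq> 0"
    unfolding sq using R by blast
  show "\<And>r k. r \<in> set ms \<Longrightarrow> qpoch (a * q / r) q k \<noteq> 0"
    using R by blast
  have "p\<^sup>2 / a * q / p = q * y"
    using p0 by (simp add: y_def power2_eq_square flip: p_def)
  then show "qpoch (q * y) q k \<noteq> 0" for k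
    using R by (metis list.set_intros(1))
  show "qpoch (a * q * y / r) q k \<noteq> 0" if "r \<in> set ms" for r k
  proof (cases "r = p")
    case True
    then have "a * q * y / r = q"
      using a p0 by (simp add: y_def flip: p_def)
    then show ?thesis
      using qpoch_nonzero[OF q qpoch_inf_self_nonzero[OF q]] by simp
  next
    case False
    then have "p * r / a \<in> set (p # map (\<lambda>r. p * r / a) (others i ms))"
      using that set_others[OF i] by (auto simp: p_def)
    then have "qpoch (p\<^sup>2 / a * q / (p * r / a)) q k \<noteq> 0"
      using R by blast
    moreover have "p\<^sup>2 / a * q / (p * r / a) = a * q * y / r"
      using a p0 by (simp add: y_def power2_eq_square mult_ac flip: p_def)
    ultimately show ?thesis
      by simp
  qed
  show "qpoch_inf (r * y) q \<noteq> 0" if "r \<in> set ms" for r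
  proof (cases "r = p")
    case True
    then have "r * y = a * y\<^sup>2"
      using a by (simp add: y_def power2_eq_square flip: p_def)
    moreover have "a * y\<^sup>2 * q = p\<^sup>2 * q / a"
      by (simp add: sq)
    ultimately show ?thesis
      using qpoch_inf_rec[OF q, of "a * y\<^sup>2"] ay R by simp
  next
    case False
    then have "r \<in> set (others i ms)"
      using that set_others[OF i] by (auto simp: p_def)
    then have "qpoch_inf (p * r / a) q \<noteq> 0"
      using R by blast
    then show ?thesis
      by (simp add: y_def mult.commute flip: p_def)
  qed
  show "qpoch_inf (a / (ms ! i)) q \<noteq> 0"
    using R by (simp add: p_def)
qed

lemma Phi_regular_imp_wp_regular:
  assumes q: "norm q < 1" and i: "i < length ps + 2" and reg: "Phi_regular i a (ps @ [g, h]) q"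
  shows "wp_regular a 1 q ps g h" "wp_regular a ((ps @ [g, h]) ! i / a) q ps g h"
proof -
  have len: "i < length (ps @ [g, h])"
    using i by simp
  note D = Phi_regularD[OF q len reg]
  show "wp_regular a ((ps @ [g, h]) ! i / a) q ps g h"
    unfolding wp_regular_def using D(7,8) by auto
  show "wp_regular a 1 q ps g h"
    unfolding wp_regular_def mult_1_right
    using D(6) qpoch_nonzero[OF q qpoch_inf_self_nonzero[OF q]] by auto
qed

text \<open>All changes are single factors split off by \<open>qpoch_inf_rec\<close>. With
  polynomial factors on both sides the equation can be used for a step down as well as for a step
  up.\<close>

lemma phi_ratio_shift:
  assumes q: "norm q < 1" and nz: "q \<noteq> 0" "1 - a * q / r \<noteq> 0" "1 - p * r / (a * q) \<noteq> 0"
  shows "phi_ratio a q p (r / q) * ((1 - p * q / r) * (1 - p * r / (a * q))) = phi_ratio a q p r * ((1 - r / q) * (1 - a * q / r))"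
proof -
  have rec: "qpoch_inf (r / q) q = (1 - r / q) * qpoch_inf r q"
    "qpoch_inf (p * q / r) q = (1 - p * q / r) * qpoch_inf (p * q / (r / q)) q"
    "qpoch_inf (a * q / r) q = (1 - a * q / r) * qpoch_inf (a * q / (r / q)) q"
    "qpoch_inf (p * (r / q) / a) q = (1 - p * r / (a * q)) * qpoch_inf (p * r / a) q"
    using qpoch_inf_rec[OF q, of "r / q"] qpoch_inf_rec[OF q, of "p * q / r"] qpoch_inf_rec[OF q, of "a * q / r"]
      qpoch_inf_rec[OF q, of "p * r / (a * q)"] nz(1) by (simp_all add: mult.commute)
  have "(t * r' * p') / (a' * (w * y)) * (u * w) = (r' * (u * p')) / (v * a' * y) * (t * v)"
    if "v \<noteq> 0" "w \<noteq> 0" for t r' p' a' w y u v :: complex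
    using that by simp
  then show ?thesis
    unfolding phi_ratio_def rec using nz(2,3) by blast
qed

text \<open>This explains the prefactor in Phi: it converts the limit on the second grid into the
  one on the first. All infinite products match except for the first factors belonging to p / a and
  a / p, and (1 - y) / (1 - 1 / y) = -y supplies the sign. The remaining y is matched by the factor
  \<open>y\<close> in \<open>contiguous_grid\<close>.\<close>

lemma phi_factor_limit:
  assumes q: "norm q < 1" and i: "i < length ms" and reg: "Phi_regular i a ms q"
  defines "y \<equiv> ms ! i / a"
  shows "phi_factor i a ms q / (1 - a * y\<^sup>2) * (qpoch_inf (a * y) q * (\<Prod>r\<leftarrow>ms. qpoch_inf (r * y) q))
      / (qpoch_inf (q * y) q * (\<Prod>r\<leftarrow>ms. qpoch_inf (a * q * y / r) q)) = - y * wp_limit a q ms"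
proof -
  define p where "p = ms ! i"
  note D = Phi_regularD[OF q i reg, folded y_def, folded p_def]
  have p: "p \<in> set ms" "p \<noteq> 0" "p = a * y"
    using i D(1,3) by (auto simp: p_def y_def dest: nth_mem)
  have o: "set (others i ms) \<subseteq> set ms"
    using set_others[OF i] by blast
  have y1: "1 - y \<noteq> 0" "1 - 1 / y \<noteq> 0"
  proof -
    have "qpoch (a / p) q 1 \<noteq> 0"
      by (rule qpoch_nonzero[OF q D(10)])
    then show "1 - y \<noteq> 0" "1 - 1 / y \<noteq> 0"
      using D(1,4) by (auto simp: qpoch_Suc p(3) field_simps)
  qed
  have nz: "qpoch_inf (q * y) q \<noteq> 0" "qpoch_inf (a * q / p) q \<noteq> 0" "qpoch_inf (p * y) q \<noteq> 0" "qpoch_inf q q \<noteq> 0"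
    by (rule qpoch_inf_nonzero[OF q D(7)] qpoch_inf_nonzero[OF q D(6)[OF p(1)]] D(9)[OF p(1)] qpoch_inf_self_nonzero[OF q])+
  have nz': "(\<Prod>r\<leftarrow>others i ms. qpoch_inf (r * y) q) \<noteq> 0"
    by (rule prod_list_map_nonzero) (use D(9) o in blast)
  have nz'': "(\<Prod>r\<leftarrow>others i ms. qpoch_inf (a * q * y / r) q) \<noteq> 0"
    by (rule prod_list_map_nonzero, rule qpoch_inf_nonzero[OF q]) (use D(8) o in blast)
  have e: "qpoch_inf (a / p) q = (1 - 1 / y) * qpoch_inf (a * q / p) q"
    "qpoch_inf (p / a) q = (1 - y) * qpoch_inf (q * y) q"
    "qpoch_inf (p * y) q = (1 - a * y\<^sup>2) * qpoch_inf (p\<^sup>2 * q / a) q"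
    using qpoch_inf_rec[OF q, of "a / p"] qpoch_inf_rec[OF q, of y] qpoch_inf_rec[OF q, of "p * y"] D(1)
    by (simp_all add: p(3) mult_ac power2_eq_square)
  have f: "phi_ratio a q p r = (qpoch_inf r q * qpoch_inf (a * q * y / r) q) / (qpoch_inf (a * q / r) q * qpoch_inf (r * y) q)" for r
    using D(1) by (simp add: phi_ratio_def p(3) mult_ac)
  have pq: "a * q * y / p = q"
    using D(1,4) by (simp add: p(3))
  have "phi_factor i a ms q / (1 - a * y\<^sup>2) * (qpoch_inf (a * y) q * (\<Prod>r\<leftarrow>ms. qpoch_inf (r * y) q))
      / (qpoch_inf (q * y) q * (\<Prod>r\<leftarrow>ms. qpoch_inf (a * q * y / r) q))
    = (1 - y) / (1 - 1 / y) * wp_limit a q ms"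
    unfolding phi_factor_def Let_def wp_limit_def prod_list_others[OF i] f prod_list_map_divide prod_list_map_mult
      p_def[symmetric] pq e(1,2) p(3)[symmetric]
    using nz nz' nz'' D(5) unfolding e(3) by (simp add: mult_ac)
  also have "(1 - y) / (1 - 1 / y) = - y"
    using D(4) y1 by (simp add: field_simps)
  finally show ?thesis .
qed

lemma phi_second_eq:
  assumes q: "norm q < 1" and i: "i < length ps + 2" and reg: "Phi_regular i a (ps @ [g, h]) q"
    and S: "vwp_term a y q ps g h sums S"
    and y: "y = (ps @ [g, h]) ! i / a"
  shows "phi_second i a (ps @ [g, h]) q = phi_factor i a (ps @ [g, h]) q / (1 - a * y\<^sup>2) * S"
proof -
  have len: "i < length (ps @ [g, h])"
    using i by simp
  show ?thesis
    using W10_9_second_eq[OF i Phi_regularD(1,3)[OF q len reg] S[unfolded y]]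
    unfolding phi_second_def Let_def y by simp
qed

section \<open>Second series with the distinguished parameter among b, ..., f\<close>

lemma others_append:
  assumes "i < length ps"
  shows "others i (ps @ rs) = others i ps @ rs"
  using assms by (simp add: others_def)

locale contiguous_second_series =
  fixes a q g h :: complex and ps :: "complex list" and i :: nat
  assumes q: "norm q < 1" "q \<noteq> 0" and len: "length ps = 5" and nz: "g \<noteq> 0" "h \<noteq> 0"
    and bal: "prod_list ps * g * h = a^3 * q\<^sup>2"
    and ne: "1 - h * q / g \<noteq> 0" "1 - g * q / h \<noteq> 0" and i: "i < 5"
    and reg: "Phi_regular i a (ps @ [g, h]) q" "Phi_regular i a (ps @ [g / q, h * q]) q"
      "Phi_regular i a (ps @ [g * q, h / q]) q"

sublocale contiguous_second_series \<subseteq> three_term_relation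
  "(1 - h) * (1 - a / h) * shift_coeff a q ps g h"
  "(1 - g) * (1 - a / g) * shift_coeff a q ps h g"
  "(1 - a * q / (g * h)) * (g - h) * (\<Prod>p\<leftarrow>ps. 1 - p)"
  "phi_second i a (ps @ [g, h]) q"
  "phi_second i a (ps @ [g / q, h * q]) q"
  "phi_second i a (ps @ [g * q, h / q]) q"
  "- ((1 - a * q / (g * h)) * ((1 - a * q / h) * (1 - a * q / g) * (g - h)) * wp_limit a q (ps @ [g, h]))"
proof (unfold_locales, goal_cases)
  case 1
  define P0 where "P0 = phi_second i a (ps @ [g, h]) q"
  define P1 where "P1 = phi_second i a (ps @ [g / q, h * q]) q"
  define P2 where "P2 = phi_second i a (ps @ [g * q, h / q]) q"
  have "(1 - h) * (1 - a / h) * shift_coeff a q ps g h * (P1 - P0)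
         - (1 - g) * (1 - a / g) * shift_coeff a q ps h g * (P2 - P0)
         + (1 - a * q / (g * h)) * (g - h) * (\<Prod>p\<leftarrow>ps. 1 - p) * P0
    = - ((1 - a * q / (g * h)) * ((1 - a * q / h) * (1 - a * q / g) * (g - h)) * wp_limit a q (ps @ [g, h]))"
  proof -
    define p where "p = ps ! i"
    define y where "y = p / a"
    have nth: "(ps @ [r, s]) ! i = p" for r s
      using i len by (simp add: p_def nth_append)
    have i': "i < length (ps @ [r, s])" "i < length ps + 2" "i < length ps" for r s :: complex
      using i len by simp_all
    note D0 = Phi_regularD[OF q(1) i'(1) reg(1), unfolded nth, folded y_def]
    note D1 = Phi_regularD[OF q(1) i'(1) reg(2), unfolded nth, folded y_def]
    note D2 = Phi_regularD[OF q(1) i'(1) reg(3), unfolded nth, folded y_def]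
    have w: "wp_regular a y q ps g h" "wp_regular a y q ps (g / q) (h * q)" "wp_regular a y q ps (g * q) (h / q)"
      using Phi_regular_imp_wp_regular(2)[OF q(1) i'(2)] reg unfolding nth y_def by blast+
    have ps0: "0 \<notin> set ps" and p: "p \<noteq> 0" "p = a * y" "p \<in> set ps"
      using D0(1,3,4) i'(3) by (auto simp: y_def p_def)
    define n where "n = (\<lambda>g h. phi_factor i a (ps @ [g, h]) q / (1 - a * y\<^sup>2))"
    define S where "S = (\<lambda>g h. suminf (vwp_term a y q ps g h))"
    have S: "vwp_term a y q ps g h sums S g h" if "wp_regular a y q ps g h" for g h
      unfolding S_def using that by (intro summable_sums vwp_term_summable q)
    have P: "phi_second i a (ps @ [g, h]) q = n g h * S g h" if "Phi_regular i a (ps @ [g, h]) q" for g h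
      unfolding n_def
    proof (rule phi_second_eq[OF q(1) i'(2) that])
      show y: "y = (ps @ [g, h]) ! i / a"
        by (simp add: nth y_def)
      show "vwp_term a y q ps g h sums S g h"
        unfolding y S_def using Phi_regular_imp_wp_regular(2)[OF q(1) i'(2) that]
        by (intro summable_sums vwp_term_summable q)
    qed
    have unit: "1 - x \<noteq> 0" if "qpoch_inf x q \<noteq> 0" for x
      using qpoch_nonzero[OF q(1) that, of 1] by (simp add: qpoch_Suc)
    have unit': "1 - x \<noteq> 0" if "\<And>k. qpoch x q k \<noteq> 0" for x
      using that[of 1] by (simp add: qpoch_Suc)
    \<comment> \<open>The first two facts come from the shifted functions: their regularity excludes
      zeros of the infinite products with base points g y / q and h y / q. This justifies the
      division in the definition of \<open>m\<close> below.\<close>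
    have gy: "1 - g * y / q \<noteq> 0" "1 - h * y / q \<noteq> 0" "1 - g * y \<noteq> 0" "1 - h * y \<noteq> 0"
      using unit[OF D1(9), of "g / q"] unit[OF D2(9), of "h / q"] unit[OF D0(9), of g] unit[OF D0(9), of h] by simp_all
    have ag: "1 - a * q / g \<noteq> 0" "1 - a * q / h \<noteq> 0" "1 - a / g \<noteq> 0" "1 - a / h \<noteq> 0"
      using unit'[OF D0(6), of g] unit'[OF D0(6), of h] unit'[OF D2(6), of "g * q"] unit'[OF D1(6), of "h * q"] q(2)
      by simp_all
    have shift: "(1 - h) * (1 - a / h) * n (g / q) (h * q) * (1 - a * q * y / g) * (1 - g * y / q)
        = (1 - g / q) * (1 - a * q / g) * ((1 - h * y) * (1 - a * y / h)) * n g h"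
      if "1 - a * q / g \<noteq> 0" "1 - a / h \<noteq> 0" "1 - g * y / q \<noteq> 0" "1 - h * y \<noteq> 0" for g h
    proof -
      have 1: "phi_ratio a q p (g / q) * ((1 - a * q * y / g) * (1 - g * y / q)) = phi_ratio a q p g * ((1 - g / q) * (1 - a * q / g))"
        using phi_ratio_shift[OF q that(1), of p] that(3) D0(1) by (simp add: p(2) mult_ac)
      \<comment> \<open>The step from h q down to h, read backwards, is the step from h up to h
        q.\<close>
      have 2: "phi_ratio a q p h * ((1 - a * y / h) * (1 - h * y)) = phi_ratio a q p (h * q) * ((1 - h) * (1 - a / h))"
        using phi_ratio_shift[OF q, of a "h * q" p] that(2,4) D0(1) q(2) by (simp add: p(2) mult_ac)
      define c where "c = (qpoch_inf (a * q) q * qpoch_inf (p / a) q) / (qpoch_inf (p\<^sup>2 * q / a) q * qpoch_inf (a / p) q)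
         * (\<Prod>r\<leftarrow>others i ps. phi_ratio a q p r) / (1 - a * y\<^sup>2)"
      have c: "n g h = c * (phi_ratio a q p g * phi_ratio a q p h)" for g h
        unfolding n_def phi_factor_def Let_def nth others_append[OF i'(3)] c_def by (simp add: mult_ac)
      have "(1 - h) * (1 - a / h) * n (g / q) (h * q) * (1 - a * q * y / g) * (1 - g * y / q)
        = c * (phi_ratio a q p (g / q) * ((1 - a * q * y / g) * (1 - g * y / q))) * (phi_ratio a q p (h * q) * ((1 - h) * (1 - a / h)))"
        unfolding c by (simp only: mult_ac)
      also have "\<dots> = (1 - g / q) * (1 - a * q / g) * ((1 - h * y) * (1 - a * y / h)) * n g h"
        unfolding 1 2[symmetric] c by (simp only: mult_ac)
      finally show ?thesis .
    qed
    have n_comm: "n g h = n h g" for g h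
      unfolding n_def phi_factor_def Let_def nth others_append[OF i'(3)] by (simp add: mult_ac)
    define m where "m = n g h / ((1 - g * y / q) * (1 - h * y / q))"
    have grid: "y * ((1 - h) * (1 - a / h) * shift_coeff a q ps g h * (n (g / q) (h * q) * S (g / q) (h * q) - n g h * S g h)
           - (1 - g) * (1 - a / g) * shift_coeff a q ps h g * (n (g * q) (h / q) * S (g * q) (h / q) - n g h * S g h)
           + (1 - a * q / (g * h)) * (g - h) * (\<Prod>p\<leftarrow>ps. 1 - p) * (n g h * S g h))
      = (1 - a * q / (g * h)) * m * ((1 - a * q / h) * (1 - a * q / g) * (g - h)
          * (wp_ratio_inf a y q ps g h - (1 - y) * (\<Prod>p\<leftarrow>ps. 1 - a * y / p)))"
    proof (rule contiguous_grid[OF q(1) D0(4) len ps0 D0(1) q(2) nz bal ne w])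
      show "n g h = m * ((1 - g * y / q) * (1 - h * y / q))"
        using gy by (simp add: m_def)
      have m: "m * (1 - h * y / q) = n g h / (1 - g * y / q)" "m * (1 - g * y / q) = n h g / (1 - h * y / q)"
        using gy by (simp_all add: m_def n_comm[of h g])
      show "(1 - h) * (1 - a / h) * n (g / q) (h * q) * (1 - a * q * y / g)
        = (1 - g / q) * (1 - a * q / g) * ((1 - h * y) * (1 - a * y / h)) * (m * (1 - h * y / q))"
        unfolding m times_divide_eq_right nonzero_eq_divide_eq[OF gy(1)] by (rule shift[OF ag(1,4) gy(1,4)])
      show "(1 - g) * (1 - a / g) * n (g * q) (h / q) * (1 - a * q * y / h)
        = (1 - h / q) * (1 - a * q / h) * ((1 - g * y) * (1 - a * y / g)) * (m * (1 - g * y / q))"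
        unfolding m n_comm[of "g * q"] times_divide_eq_right nonzero_eq_divide_eq[OF gy(2)] by (rule shift[OF ag(2,3) gy(2,3)])
    qed (intro S w)+
    \<comment> \<open>The distinguished p belongs to \<open>ps\<close> and a y / p = 1, so the
      boundary value of the telescoping sum is 0.\<close>
    have zero: "(\<Prod>p\<leftarrow>ps. 1 - a * y / p) = 0"
      unfolding prod_list_zero_iff set_map p(2)[symmetric]
      by (rule image_eqI[of _ _ p]) (use p(1,3) in simp_all)
    have lim: "m * wp_ratio_inf a y q ps g h = - y * wp_limit a q (ps @ [g, h])"
    proof -
      have rec: "qpoch_inf (r * y / q) q = (1 - r * y / q) * qpoch_inf (r * y) q" for r
        using qpoch_inf_rec_div[OF q] .
      have "m * wp_ratio_inf a y q ps g h = n g h * (qpoch_inf (a * y) q * (\<Prod>r\<leftarrow>ps @ [g, h]. qpoch_inf (r * y) q))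
        / (qpoch_inf (q * y) q * (\<Prod>r\<leftarrow>ps @ [g, h]. qpoch_inf (a * q * y / r) q))"
      proof -
        have "N / (u * v) * (A * C * (u * G) * (v * H) / (Q * D * E * F)) = N * (A * (C * (G * H))) / (Q * (D * (E * F)))"
          if "u \<noteq> 0" "v \<noteq> 0" for N u v A C G H Q D E F :: complex
          using that by (simp add: mult_ac)
        from this[OF gy(1,2)] show ?thesis
          unfolding m_def wp_ratio_inf_def rec map_append prod_list.append list.map prod_list.Cons prod_list.Nil mult_1_right .
      qed
      also have "\<dots> = - y * wp_limit a q (ps @ [g, h])"
        using phi_factor_limit[OF q(1) i'(1) reg(1)] unfolding n_def nth y_def .
      finally show ?thesis .
    qed
    have "K * m * (C * (R - (1 - y) * 0)) = y * - (K * C * L)" if "m * R = - y * L" for K C R L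
    proof -
      have "K * m * (C * (R - (1 - y) * 0)) = K * C * (m * R)"
        by simp
      then show ?thesis
        unfolding that by simp
    qed
    from this[OF lim] have "y * ((1 - h) * (1 - a / h) * shift_coeff a q ps g h * (n (g / q) (h * q) * S (g / q) (h * q) - n g h * S g h)
           - (1 - g) * (1 - a / g) * shift_coeff a q ps h g * (n (g * q) (h / q) * S (g * q) (h / q) - n g h * S g h)
           + (1 - a * q / (g * h)) * (g - h) * (\<Prod>p\<leftarrow>ps. 1 - p) * (n g h * S g h))
      = y * - ((1 - a * q / (g * h)) * ((1 - a * q / h) * (1 - a * q / g) * (g - h)) * wp_limit a q (ps @ [g, h]))"
      unfolding grid zero .
    then show ?thesis
      unfolding P0_def P1_def P2_def P[OF reg(1)] P[OF reg(2)] P[OF reg(3)]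
      using D0(4) mult_left_cancel by blast
  qed
  then show ?case
    unfolding P0_def P1_def P2_def .
qed

lemmas (in contiguous_second_series) three_term = three_term_relation_axioms

subsection \<open>Shifted distinguished parameter\<close>

text \<open>With t = a q / g = q / y this turns the product in \<open>shift_coeff\<close> into the
  product of the factors 1 - p y / q, which occurs in the ratio of the prefactors.\<close>

lemma prod_list_one_minus_divide:
  fixes t :: "'a :: field"
  assumes "t \<noteq> 0" "0 \<notin> set ps"
  shows "(\<Prod>p\<leftarrow>ps. 1 - t / p) = (- t) ^ length ps / prod_list ps * (\<Prod>p\<leftarrow>ps. 1 - p / t)"
  using assms(2)
proof (induction ps)
  case (Cons p ps)
  have "1 - t / p = - t / p * (1 - p / t)"
    using Cons.prems assms(1) by (simp add: field_simps)
  then show ?case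
    using Cons by simp
qed simp

text \<open>
  The grids of the three series start at \<open>y / q\<close>, \<open>y\<close> and \<open>y q\<close>. The terms from \<open>y q\<close> on are covered by
  \<open>contiguous_grid\<close>; the terms at \<open>y / q\<close> and \<open>y\<close> are computed directly, since the common factor
  may have a pole at \<open>y\<close>.
\<close>
lemma contiguous_grid_self:
  assumes q: "norm q < 1" and y: "y \<noteq> 0" "a * y = g" "1 - y \<noteq> 0"
    and len: "length ps = 5" and nz: "0 \<notin> set ps" "a \<noteq> 0" "q \<noteq> 0" "g \<noteq> 0" "h \<noteq> 0"
    and bal: "prod_list ps * g * h = a^3 * q\<^sup>2"
    and ne: "1 - h * q / g \<noteq> 0" "1 - g * q / h \<noteq> 0"
    and reg: "wp_regular a y q ps g h" "wp_regular a (y / q) q ps (g / q) (h * q)"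
      "wp_regular a (y * q) q ps (g * q) (h / q)"
    and gy: "1 - g * y / q \<noteq> 0" "1 - g * y / q\<^sup>2 \<noteq> 0" "(\<Prod>p\<leftarrow>ps. 1 - p * y / q) \<noteq> 0"
    and n1: "(1 - h) * (1 - a / h) * n1 * (q * (\<Prod>p\<leftarrow>ps. 1 - p * y / q) * (1 - g * y / q\<^sup>2)) * (1 - g * y / q)
      = (1 - a * q / g) * (1 - a * y / h) * (1 - a * y / (h * q)) * n0 * ((1 - y) * (\<Prod>p\<leftarrow>ps. 1 - a * y / p))"
    and n2: "(1 - a / g) * n2 * ((1 - a * q * (y * q) / h) * (1 - q * y) * (\<Prod>p\<leftarrow>ps. 1 - a * q * y / p) * (1 - a * q * y / h))
      = (1 - h / q) * (1 - a * q / h) * ((1 - g * (y * q)) * (1 - g * y)) * n0 * (q * (\<Prod>p\<leftarrow>ps. 1 - p * y))"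
    and S0: "vwp_term a y q ps g h sums S0"
    and S1: "vwp_term a (y / q) q ps (g / q) (h * q) sums S1"
    and S2: "vwp_term a (y * q) q ps (g * q) (h / q) sums S2"
  shows "y * ((1 - h) * (1 - a / h) * shift_coeff a q ps g h * (n1 * S1 - n0 * S0)
         - (1 - g) * (1 - a / g) * shift_coeff a q ps h g * (n2 * S2 - n0 * S0)
         + (1 - a * q / (g * h)) * (g - h) * (\<Prod>p\<leftarrow>ps. 1 - p) * (n0 * S0))
    = (1 - a * q / (g * h)) * ((1 - a * q / h) * (1 - a * q / g) * (g - h))
      * (n0 * ((1 - a * y) * (\<Prod>p\<leftarrow>ps. 1 - p * y)
           / ((1 - q * y) * (\<Prod>p\<leftarrow>ps. 1 - a * q * y / p) * (1 - a * q * y / g) * (1 - a * q * y / h)))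
         * wp_ratio_inf a (y * q) q ps g h)"
proof -
  have unit: "1 - x \<noteq> 0" if "\<And>k. qpoch x q k \<noteq> 0" for x
    using that[of 1] by (simp add: qpoch_Suc)
  have reg1: "wp_regular a y q ps (g / q) (h * q)"
    using wp_regular_shift[OF reg(2)] nz(3) by simp
  have d: "1 - q * y \<noteq> 0" "1 - a * q * y / g \<noteq> 0" "1 - a * q * y / h \<noteq> 0" "1 - a * q * y / (h * q) \<noteq> 0"
    "1 - a * q * y / (g / q) \<noteq> 0"
    and dP: "\<And>p. p \<in> set ps \<Longrightarrow> 1 - a * q * y / p \<noteq> 0"
    using reg(1) reg1 unfolding wp_regular_def by (intro unit; blast)+
  have dP: "(\<Prod>p\<leftarrow>ps. 1 - a * q * y / p) \<noteq> 0"
    using dP by (rule prod_list_map_nonzero)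
  have d': "1 - a * y / h \<noteq> 0" "1 - a * q * (y * q) / g \<noteq> 0"
    using d(4,5) nz(3) by (simp_all add: mult_ac)
  have e: "1 - a * q * (y / q) / (h * q) \<noteq> 0"
    and eP: "\<And>p. p \<in> set ps \<Longrightarrow> 1 - a * q * (y / q) / p \<noteq> 0"
    using reg(2) unfolding wp_regular_def by (intro unit; blast)+
  have e: "1 - a * y / (h * q) \<noteq> 0"
    using e nz(3) by (simp add: mult_ac)
  have eP: "(\<Prod>p\<leftarrow>ps. 1 - a * y / p) \<noteq> 0"
    using eP nz(3) by (intro prod_list_map_nonzero) (simp add: mult_ac)
  define K where "K = 1 - a * q / (g * h)"
  define C where "C = (1 - a * q / h) * (1 - a * q / g) * (g - h)"
  define A where "A = (1 - h) * (1 - a / h) * shift_coeff a q ps g h"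
  define B where "B = (1 - g) * (1 - a / g) * shift_coeff a q ps h g"
  define P where "P = (\<Prod>p\<leftarrow>ps. 1 - p)"
  define Q where "Q = (\<Prod>p\<leftarrow>ps. 1 - p * y)"
  define D where "D = (\<Prod>p\<leftarrow>ps. 1 - a * q * y / p)"
  define E where "E = (\<Prod>p\<leftarrow>ps. 1 - a * y / p)"
  define F where "F = (\<Prod>p\<leftarrow>ps. 1 - p * y / q)"
  define R0 where "R0 = 1 / ((1 - a * q * y / g) * (1 - a * q * y / h))"
  \<comment> \<open>The weight for the grid from y q: \<open>n0\<close> times the step ratio
    \<open>w0\<close> without (1 - g y)(1 - h y). In this form it needs no division by 1 - h y /
    q.\<close>
  define n where "n = n0 * (q * ((1 - a * y) * Q / ((1 - q * y) * D * (1 - a * q * y / g) * (1 - a * q * y / h))))"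
  define w0 where "w0 = q * ((1 - a * y) * Q * (1 - g * y) * (1 - h * y)
     / ((1 - q * y) * D * (1 - a * q * y / g) * (1 - a * q * y / h)))"
  define w1 where "w1 = q * ((1 - a * y) * Q * (1 - g * y / q) * (1 - h * (y * q))
     / ((1 - q * y) * D * (1 - a * q * (y * q) / g) * (1 - a * y / h)))"
  \<comment> \<open>The weight of the series with g / q once its first point y / q is removed and it
    is compared on the grid from y; \<open>l1_eq\<close> provides the ratio condition of
    \<open>shift_diff\<close>.\<close>
  define l1 where "l1 = n1 * (q * ((1 - g / q) * F * (1 - g * y / q\<^sup>2) * (1 - h * y)
     / ((1 - y) * E * (1 - a * q * y / g) * (1 - a * y / (h * q)))))"
  define T where "T = (\<lambda>g h. suminf (vwp_term a (y * q) q ps g h))"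
  have T: "vwp_term a (y * q) q ps g h sums T g h" if "wp_regular a y q ps g h" for g h
    unfolding T_def using wp_regular_shift[OF that] by (intro summable_sums vwp_term_summable q)
  have start: "vwp_term a z q ps u v 0 = 1 - a * z\<^sup>2" for z u v
    by (simp add: vwp_term_def map_replicate_const)
  have w0: "vwp_term a y q ps g h (Suc k) = w0 * vwp_term a (y * q) q ps g h k" for k
    unfolding vwp_term_Suc w0_def Q_def D_def ..
  have w1: "vwp_term a y q ps (g / q) (h * q) (Suc k) = w1 * vwp_term a (y * q) q ps (g / q) (h * q) k" for k
    unfolding vwp_term_Suc w1_def Q_def D_def using nz(3) by (simp add: mult_ac)
  have l1: "n1 * vwp_term a (y / q) q ps (g / q) (h * q) (Suc k) = l1 * vwp_term a y q ps (g / q) (h * q) k" for k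
  proof -
    have arg0: "a * (y / q) = g / q"
      using y(2) by simp
    have arg: "g / q * (y / q) = g * y / q\<^sup>2" "h * q * (y / q) = h * y"
      "q * (y / q) = y" "a * q * (y / q) / (g / q) = a * q * y / g" "y / q * q = y"
      using nz(3) by (simp_all add: power2_eq_square)
    have arg': "a * q * (y / q) / p = a * y / p" for p
      using nz(3) by simp
    have arg'': "p * (y / q) = p * y / q" for p
      by simp
    show ?thesis
      unfolding vwp_term_Suc l1_def F_def E_def unfolding arg0 arg unfolding arg' unfolding arg'' by simp
  qed
  have sum0: "S0 = w0 * T g h + (1 - a * y\<^sup>2)"
  proof -
    have "(\<lambda>k. vwp_term a y q ps g h (Suc k)) sums (w0 * T g h)"
      unfolding w0 by (intro sums_mult T reg)
    from sums_Suc[OF this] show ?thesis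
      using sums_unique2[OF S0] unfolding start by simp
  qed
  have sum1: "n1 * S1 = l1 * (w1 * T (g / q) (h * q) + (1 - a * y\<^sup>2)) + n1 * (1 - a * (y / q)\<^sup>2)"
  proof -
    have "(\<lambda>k. vwp_term a y q ps (g / q) (h * q) (Suc k)) sums (w1 * T (g / q) (h * q))"
      unfolding w1 by (intro sums_mult T reg1)
    from sums_Suc[OF this] have "(\<lambda>k. n1 * vwp_term a (y / q) q ps (g / q) (h * q) (Suc k))
        sums (l1 * (w1 * T (g / q) (h * q) + (1 - a * y\<^sup>2)))"
      unfolding l1 start by (rule sums_mult)
    from sums_Suc[OF this] show ?thesis
      using sums_unique2[OF sums_mult[OF S1, of n1]] unfolding start by simp
  qed
  have sum2: "S2 = T (g * q) (h / q)"
    using S2 unfolding T_def by (rule sums_unique)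
  define n' where "n' = n0 / (1 - g * y / q)"
  \<comment> \<open>Since y = g / a, the number \<open>K\<close> is -(a q / (g h)) times 1 - h y /
    q. Both vanish together, and \<open>v\<close> is defined without dividing by either.\<close>
  define v where "v = - (a * q / (g * h)) * n'"
  have n0: "n0 = n' * (1 - g * y / q)"
    using gy(1) by (simp add: n'_def)
  have v: "K * n' = v * (1 - h * y / q)"
  proof -
    have "K = - (a * q / (g * h)) * (1 - h * y / q)"
      using nz y unfolding K_def y(2)[symmetric] by (simp add: field_simps)
    then show ?thesis
      by (simp add: v_def)
  qed
  have n1': "(1 - h) * (1 - a / h) * n1 * (q * F * (1 - g * y / q\<^sup>2))
      = (1 - a * q / g) * (1 - a * y / h) * (1 - a * y / (h * q)) * n' * ((1 - y) * E)"
    using n1 gy(1) unfolding n'_def F_def E_def by (simp add: nonzero_eq_divide_eq)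
  have l1_eq: "(1 - h) * (1 - a / h) * l1 * (1 - a * q * y / g)
      = (1 - g / q) * (1 - a * q / g) * ((1 - h * y) * (1 - a * y / h)) * n'"
  proof -
    have "(1 - h) * (1 - a / h) * l1 * (1 - a * q * y / g)
      = ((1 - h) * (1 - a / h) * n1 * (q * F * (1 - g * y / q\<^sup>2))) * ((1 - g / q) * (1 - h * y))
         / ((1 - y) * E * (1 - a * y / (h * q)))"
    proof -
      have "r * s * (n1 * (q * (c1 * F * c2 * c3 / (y1 * E * c * e)))) * c = (r * s * n1 * (q * F * c2)) * (c1 * c3) / (y1 * E * e)"
        if "c \<noteq> 0" for r s c1 c2 c3 y1 c e
        using that by (simp add: mult_ac)
      then show ?thesis
        unfolding l1_def using d(2) by blast
    qed
    also have "\<dots> = (1 - g / q) * (1 - a * q / g) * ((1 - h * y) * (1 - a * y / h)) * n'"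
    proof -
      have "(g1 * g2 * f * m * (y1 * E)) * (c1 * c3) / (y1 * E * f) = c1 * g1 * (c3 * g2) * m"
        if "y1 \<noteq> 0" "f \<noteq> 0" for g1 g2 f m y1 c1 c3
        using that eP[folded E_def] by (simp add: mult_ac)
      then show ?thesis
        unfolding n1' using y(3) e by blast
    qed
    finally show ?thesis .
  qed
  \<comment> \<open>At x = y / q only the series with g / q has a term. Its contribution cancels the
    lower boundary term that the telescoping leaves at x = y in \<open>second\<close>.\<close>
  have first: "y * (A * (n1 * (1 - a * (y / q)\<^sup>2))) = v * (C * ((1 - y) * E))"
  proof -
    \<comment> \<open>The value of (-t)^5 / \<open>prod_list ps\<close> for t = a q / g, where
      balancing gives a^3 q^2 / (g h) for the product.\<close>
    define \<rho> where "\<rho> = - (a\<^sup>2 * q ^ 3 * h / g ^ 4)"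
    have yq: "y = g / a"
      using nz y by (simp add: field_simps)
    have "(\<Prod>p\<leftarrow>ps. 1 - a * q / (g * p)) = (\<Prod>p\<leftarrow>ps. 1 - (a * q / g) / p)"
      by simp
    also have "\<dots> = (- (a * q / g)) ^ 5 / prod_list ps * (\<Prod>p\<leftarrow>ps. 1 - p / (a * q / g))"
      using prod_list_one_minus_divide[of "a * q / g" ps] nz len by simp
    also have "(\<Prod>p\<leftarrow>ps. 1 - p / (a * q / g)) = F"
      by (simp add: F_def yq mult_ac)
    also have "(- (a * q / g)) ^ 5 / prod_list ps = \<rho>"
    proof -
      have pp: "prod_list ps = a ^ 3 * q\<^sup>2 / (g * h)"
        using bal nz by (simp add: field_simps)
      show ?thesis
        unfolding pp \<rho>_def using nz(2-5) by (simp add: field_simps eval_nat_numeral)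
    qed
    finally have \<rho>: "shift_coeff a q ps g h = g * (1 - a * q / h) * (\<rho> * F) / (1 - h * q / g)"
      by (simp add: shift_coeff_def)
    \<comment> \<open>Because a y = g, the factor 1 - a y / (h q) is a multiple of 1 - h q / g and
      cancels that denominator, while 1 - a y / h produces g - h.\<close>
    have scalar: "y * (g * \<rho> / (1 - h * q / g) * ((1 - a * y / h) * (1 - a * y / (h * q)))) = - (a * q / (g * h)) * (g - h) * q"
    proof -
      have "1 - a * y / (h * q) = - (g / (h * q)) * (1 - h * q / g)"
        using nz y(2) by (simp add: field_simps)
      then have "y * (g * \<rho> / (1 - h * q / g) * ((1 - a * y / h) * (1 - a * y / (h * q))))
        = y * (g * \<rho> * ((1 - a * y / h) * (- (g / (h * q)))))"
        using ne(1) by auto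
      also have "\<dots> = - (a * q / (g * h)) * (g - h) * q"
        unfolding y(2) unfolding \<rho>_def yq using nz by (simp add: field_simps eval_nat_numeral)
      finally show ?thesis .
    qed
    have sq: "a * (y / q)\<^sup>2 = g * y / q\<^sup>2"
      using y(2) by (simp add: power2_eq_square)
    have "(q * F) * (y * (A * (n1 * (1 - a * (y / q)\<^sup>2))))
      = y * shift_coeff a q ps g h * ((1 - h) * (1 - a / h) * n1 * (q * F * (1 - g * y / q\<^sup>2)))"
      unfolding A_def sq by (simp only: mult_ac)
    also have "\<dots> = F * (y * (g * \<rho> / (1 - h * q / g) * ((1 - a * y / h) * (1 - a * y / (h * q)))))
       * ((1 - a * q / h) * (1 - a * q / g) * n' * ((1 - y) * E))"
      unfolding n1' \<rho> by (simp only: mult_ac times_divide_eq_left times_divide_eq_right)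
    also have "\<dots> = (q * F) * (v * (C * ((1 - y) * E)))"
      unfolding scalar v_def C_def by (simp only: mult_ac minus_mult_left[symmetric] minus_mult_right[symmetric])
    finally show ?thesis
      using nz(3) gy(3)[folded F_def] by simp
  qed
  have diff_g: "A * (l1 * (1 - a * y\<^sup>2) - n0 * (1 - a * y\<^sup>2)) = v * R0 * (1 - a * y\<^sup>2) * wp_diff a q ps g h y"
    using shift_diff[OF nz(3-5) ne(1) reg(1) reg1 n0 l1_eq v[unfolded K_def], of 0]
    unfolding start A_def R0_def by (simp add: wp_ratio_def qpoch_Suc map_replicate_const)
  \<comment> \<open>The series with g q starts only at y q. At x = y its missing term counts as 0,
    and the unshifted term alone already has the form given by \<open>shift_diff\<close>: a y = g
    identifies 1 - g with 1 - a y and makes 1 - a / g a multiple of 1 - y.\<close>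
  have diff_h: "B * (n0 * (1 - a * y\<^sup>2)) = - (v * R0 * (1 - a * y\<^sup>2) * wp_diff a q ps h g y)"
  proof -
    have ag: "1 - a / g = - (a / g) * (1 - y)"
      using nz y(1) by (simp add: field_simps flip: y(2))
    have "(1 - g) * (- c * z) * (h * u * p' / w) * (n' * i * r)
       = - (- (c * q / h) * n' * (1 / (s * w)) * r * - (h\<^sup>2 / q * u * p' * z * (1 - g) * i * s))" if "s \<noteq> 0"
      for c z u p' w i r s
      using that nz by (simp add: power2_eq_square)
    from this[OF d(2)] show ?thesis
      unfolding B_def shift_coeff_def ag n0 v_def R0_def wp_diff_def y(2) by (simp add: y(2)[symmetric])
  qed
  have coeff: "K * (g - h) * P * (n0 * (1 - a * y\<^sup>2)) = v * R0 * (1 - a * y\<^sup>2) * ((g - h) * P * wp_coeff a q g h y)"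
  proof -
    have "R0 * wp_coeff a q g h y = (1 - g * y / q) * (1 - h * y / q)"
      using d(2,3) unfolding R0_def wp_coeff_def by auto
    then have "v * R0 * (1 - a * y\<^sup>2) * ((g - h) * P * wp_coeff a q g h y)
      = (v * (1 - h * y / q)) * (1 - g * y / q) * ((1 - a * y\<^sup>2) * ((g - h) * P))"
      by (simp add: mult_ac)
    then show ?thesis
      unfolding v[symmetric] n0 by (auto simp: mult_ac)
  qed
  have second: "y * (A * (l1 * (1 - a * y\<^sup>2) - n0 * (1 - a * y\<^sup>2)) + B * (n0 * (1 - a * y\<^sup>2))
       + K * (g - h) * P * (n0 * (1 - a * y\<^sup>2)))
     = C * (K * n0 * ((1 - a * y) * Q * R0) - v * ((1 - y) * E))"
  proof -
    have "y * (A * (l1 * (1 - a * y\<^sup>2) - n0 * (1 - a * y\<^sup>2)) + B * (n0 * (1 - a * y\<^sup>2))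
       + K * (g - h) * P * (n0 * (1 - a * y\<^sup>2)))
      = v * R0 * (y * (1 - a * y\<^sup>2) * (wp_diff a q ps g h y - wp_diff a q ps h g y + (g - h) * P * wp_coeff a q g h y))"
      unfolding diff_g diff_h coeff by (simp add: algebra_simps)
    also have "\<dots> = v * R0 * (C * ((1 - a * y) * Q * (1 - g * y / q) * (1 - h * y / q)
       - (1 - y) * E * (1 - a * q * y / g) * (1 - a * q * y / h)))"
      unfolding P_def C_def Q_def E_def contiguous_key[OF len nz bal] ..
    also have "\<dots> = C * ((v * (1 - h * y / q)) * (1 - g * y / q) * ((1 - a * y) * Q * R0)
       - v * ((1 - y) * E) * (R0 * ((1 - a * q * y / g) * (1 - a * q * y / h))))"
    proof -
      have "v * r * (C * (a1 * Q * g1 * h1 - y1 * E * d1 * d2))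
        = C * ((v * h1) * g1 * (a1 * Q * r) - v * (y1 * E) * (r * (d1 * d2)))" for r a1 g1 h1 y1 d1 d2
        by (simp add: algebra_simps)
      then show ?thesis .
    qed
    also have "R0 * ((1 - a * q * y / g) * (1 - a * q * y / h)) = 1"
      using d(2,3) by (auto simp: R0_def)
    finally show ?thesis
      unfolding v[symmetric] n0 by (simp only: mult_ac mult_1_left mult_1_right)
  qed
  have third: "y * (A * (l1 * w1 * T (g / q) (h * q) - n0 * w0 * T g h) - B * (n2 * T (g * q) (h / q) - n0 * w0 * T g h)
       + K * (g - h) * P * (n0 * w0 * T g h))
     = C * (K * n / q * wp_ratio_inf a (y * q) q ps g h - K * n0 * ((1 - a * y) * Q * R0))"
  proof -
    have "y * q * (A * (l1 * w1 * T (g / q) (h * q) - n0 * w0 * T g h) - B * (n2 * T (g * q) (h / q) - n0 * w0 * T g h)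
       + K * (g - h) * P * (n0 * w0 * T g h))
     = K * n * (C * (wp_ratio_inf a (y * q) q ps g h - (1 - y * q) * (\<Prod>p\<leftarrow>ps. 1 - a * (y * q) / p)))"
      unfolding A_def B_def C_def K_def P_def
    proof (rule contiguous_grid[OF q _ len nz bal ne])
      have arg: "u * (y * q) / q = u * y" "a * (y * q) / u = a * q * y / u" for u
        using nz(3) by simp_all
      show "y * q \<noteq> 0"
        using y nz by simp
      show "wp_regular a (y * q) q ps g h" "wp_regular a (y * q) q ps (g / q) (h * q)"
        "wp_regular a (y * q) q ps (g * q) (h / q)"
        using reg(1,3) reg1 by (auto intro: wp_regular_shift)
      show "n0 * w0 = n * ((1 - g * (y * q) / q) * (1 - h * (y * q) / q))"
        using nz(3) unfolding n_def w0_def by simp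
      show "(1 - h) * (1 - a / h) * (l1 * w1) * (1 - a * q * (y * q) / g)
        = (1 - g / q) * (1 - a * q / g) * ((1 - h * (y * q)) * (1 - a * (y * q) / h)) * (n * (1 - h * (y * q) / q))"
      proof -
        have "r * (l1 * (q * (c1 * Q * c2 * c3 / (c4 * D * c5 * c6)))) * c5
            = c7 * (c3 * c8) * (n' * c2 * (q * (c1 * Q / (c4 * D * c9 * c8))) * c10)"
          if "r * l1 * c9 = c7 * (c10 * c6) * n'" "c5 \<noteq> 0" "c6 \<noteq> 0" "c8 \<noteq> 0" "c9 \<noteq> 0"
          for r l1 c1 c2 c3 c4 c5 c6 c7 c8 c9 c10 D Q n' :: complex
        proof -
          have "r * l1 = c7 * (c10 * c6) * n' / c9"
            using that by (simp add: nonzero_eq_divide_eq)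
          then have "r * l1 * ((q * (c1 * Q * c2 * c3 / (c4 * D * c5 * c6))) * c5)
            = c7 * (c3 * c8) * (n' * c2 * (q * (c1 * Q / (c4 * D * c9 * c8))) * c10)"
            using that(2-5) by (simp add: mult_ac)
          then show ?thesis
            by (simp only: mult_ac)
        qed
        from this[OF l1_eq d'(2,1) d(3,2), where ?c2.0 = "1 - g * y / q"] show ?thesis
          unfolding w1_def n_def n0[symmetric] arg .
      qed
      show "(1 - g) * (1 - a / g) * n2 * (1 - a * q * (y * q) / h)
        = (1 - h / q) * (1 - a * q / h) * ((1 - g * (y * q)) * (1 - a * (y * q) / g)) * (n * (1 - g * (y * q) / q))"
      proof -
        have "u * r * n2 * c1 = c5 * (c6 * c9) * (n0 * (q * (u * Q / (c2 * D * c9 * c3))) * c7)"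
          if "r * n2 * (c1 * c2 * D * c3) = c5 * (c6 * c7) * n0 * (q * Q)" "c2 \<noteq> 0" "D \<noteq> 0" "c3 \<noteq> 0" "c9 \<noteq> 0"
          for u r n2 c1 c2 c3 c5 c6 c7 c9 D Q n0 :: complex
        proof -
          have "r * n2 * c1 = c5 * (c6 * c7) * n0 * (q * Q) / (c2 * D * c3)"
            using that by (simp add: nonzero_eq_divide_eq mult_ac)
          then have "u * (r * n2 * c1) = c5 * (c6 * c9) * (n0 * (q * (u * Q / (c2 * D * c9 * c3))) * c7)"
            using that(2-5) by (simp add: mult_ac)
          then show ?thesis
            by (simp only: mult_ac)
        qed
        from this[OF n2[folded D_def Q_def] d(1) dP[folded D_def] d(3,2), of "1 - g"] show ?thesis
          unfolding n_def y(2) arg .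
      qed
    qed (use T[OF reg(1)] T[OF reg1] S2 sum2 in simp_all)
    moreover have "n * ((1 - y * q) * (\<Prod>p\<leftarrow>ps. 1 - a * (y * q) / p)) = q * (n0 * ((1 - a * y) * Q * R0))"
    proof -
      have "(\<Prod>p\<leftarrow>ps. 1 - a * (y * q) / p) = D"
        by (simp add: D_def mult_ac)
      then show ?thesis
        using d(1-3) dP[folded D_def] unfolding n_def R0_def by (simp add: mult_ac)
    qed
    moreover have "y * X = C * (K * n / q * R - K * u)"
      if "y * q * X = K * n * (C * (R - s))" "n * s = q * u" for X R s u
    proof -
      have "q * (y * X) = C * (K * (n * R) - K * (n * s))"
        using that(1) by (simp add: algebra_simps)
      then show ?thesis
        unfolding that(2) using nz(3) by (simp add: field_simps)
    qed
    ultimately show ?thesis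
      unfolding mult.assoc[of K n0] by blast
  qed
  have nq: "n / q = n0 * ((1 - a * y) * Q / ((1 - q * y) * D * (1 - a * q * y / g) * (1 - a * q * y / h)))"
    using nz(3) by (simp add: n_def)
  \<comment> \<open>The sum is split into the point y / q, the point y and the grid from y q. The
    boundary terms of neighbouring parts cancel, and only the limit at 0 remains.\<close>
  have "y * (A * (n1 * S1 - n0 * S0) - B * (n2 * S2 - n0 * S0) + K * (g - h) * P * (n0 * S0))
    = y * (A * (n1 * (1 - a * (y / q)\<^sup>2)))
    + y * (A * (l1 * (1 - a * y\<^sup>2) - n0 * (1 - a * y\<^sup>2)) + B * (n0 * (1 - a * y\<^sup>2))
       + K * (g - h) * P * (n0 * (1 - a * y\<^sup>2)))
    + y * (A * (l1 * w1 * T (g / q) (h * q) - n0 * w0 * T g h) - B * (n2 * T (g * q) (h / q) - n0 * w0 * T g h)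
       + K * (g - h) * P * (n0 * w0 * T g h))"
    unfolding sum1 sum0 sum2 by (simp add: algebra_simps)
  also have "\<dots> = K * C * (n / q * wp_ratio_inf a (y * q) q ps g h)"
    unfolding first second third by (simp add: algebra_simps)
  finally show ?thesis
    unfolding nq A_def B_def C_def K_def P_def Q_def D_def .
qed

text \<open>Here the distinguished parameter itself moves, so the factors of all parameters change
  and not only those of g and h. Each infinite product changes by at most two factors. The divisions
  by 1 - a y^2 and 1 - a (y / q)^2 turn the prefactors into weights of the sums of
  \<open>vwp_term\<close>.\<close>

lemma phi_factor_self_shift:
  fixes a g h q :: complex and ps :: "complex list"
  assumes q: "norm q < 1" and nz: "a \<noteq> 0" "q \<noteq> 0" "g \<noteq> 0" "h \<noteq> 0"
    and i: "i = length ps" and y: "y = g / a"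
    and d: "1 - a / g \<noteq> 0" "1 - a / h \<noteq> 0" "1 - g * y \<noteq> 0" "1 - g * y / q \<noteq> 0" "1 - g * y / q\<^sup>2 \<noteq> 0"
      "(\<Prod>p\<leftarrow>ps. 1 - p * y / q) \<noteq> 0"
  shows "(1 - h) * (1 - a / h) * (phi_factor i a (ps @ [g / q, h * q]) q / (1 - a * (y / q)\<^sup>2))
        * (q * (\<Prod>p\<leftarrow>ps. 1 - p * y / q) * (1 - g * y / q\<^sup>2)) * (1 - g * y / q)
      = (1 - a * q / g) * (1 - a * y / h) * (1 - a * y / (h * q)) * (phi_factor i a (ps @ [g, h]) q / (1 - a * y\<^sup>2))
        * ((1 - y) * (\<Prod>p\<leftarrow>ps. 1 - a * y / p))"
proof -
  have ay: "a * y = g"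
    using nz y by simp
  have sq: "1 - a * y\<^sup>2 = 1 - g * y" and sq': "1 - a * (y / q)\<^sup>2 = 1 - g * y / q\<^sup>2"
    by (simp_all add: power2_eq_square flip: ay)
  have sel: "(ps @ [u, v]) ! i = u" "others i (ps @ [u, v]) = ps @ [v]" for u v
    by (simp_all add: i others_def nth_append)
  define Q where "Q = (\<Prod>p\<leftarrow>ps. qpoch_inf p q) * (\<Prod>p\<leftarrow>ps. qpoch_inf (g * q / p) q)
     / ((\<Prod>p\<leftarrow>ps. qpoch_inf (a * q / p) q) * (\<Prod>p\<leftarrow>ps. qpoch_inf (p * y) q))"
  define E where "E = (\<Prod>p\<leftarrow>ps. 1 - a * y / p)"
  define F where "F = (\<Prod>p\<leftarrow>ps. 1 - p * y / q)"
  have rec: "qpoch_inf x q = (1 - x) * qpoch_inf (x * q) q" for x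
    by (rule qpoch_inf_rec[OF q])
  have Q: "(\<Prod>r\<leftarrow>ps. phi_ratio a q g r) = Q"
    unfolding phi_ratio_def prod_list_map_divide prod_list_map_mult Q_def y by (simp add: mult.commute)
  have "(1 - a * y\<^sup>2) * qpoch_inf (g\<^sup>2 * q / a) q = qpoch_inf (g * y) q"
    using rec[of "g * y"] nz(1) by (simp add: y power2_eq_square mult_ac)
  then have S: "qpoch_inf (g\<^sup>2 * q / a) q = qpoch_inf (g * y) q / (1 - a * y\<^sup>2)"
    unfolding sq nonzero_eq_divide_eq[OF d(3)] by (simp only: mult.commute)
  have ag: "qpoch_inf (a / g) q = (1 - a / g) * qpoch_inf (a * q / g) q"
    using rec[of "a / g"] by simp
  have R: "phi_ratio a q g h = ((1 - h) * qpoch_inf (h * q) q * qpoch_inf (g * q / h) q)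
     / (qpoch_inf (a * q / h) q * qpoch_inf (h * y) q)"
    unfolding phi_ratio_def rec[of h] by (simp add: y mult.commute)
  have list: "(\<Prod>r\<leftarrow>ps @ [z]. f r) = (\<Prod>r\<leftarrow>ps. f r) * f z" for z and f :: "complex \<Rightarrow> complex"
    by simp
  have cancel: "((A * Y) / ((S / u) * T) * (Q * R)) / u = A * Y / (S * T) * Q * R" if "u \<noteq> 0"
    for A Y S u T Q R :: complex
    using that by simp
  have u: "1 - a * y\<^sup>2 \<noteq> 0" "1 - a * (y / q)\<^sup>2 \<noteq> 0"
    using d(3,5) unfolding sq sq' by simp_all
  have N0: "phi_factor i a (ps @ [g, h]) q / (1 - a * y\<^sup>2)
    = qpoch_inf (a * q) q * qpoch_inf y q / (qpoch_inf (g * y) q * ((1 - a / g) * qpoch_inf (a * q / g) q)) * Q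
     * (((1 - h) * qpoch_inf (h * q) q * qpoch_inf (g * q / h) q) / (qpoch_inf (a * q / h) q * qpoch_inf (h * y) q))"
    unfolding phi_factor_def Let_def sel list Q S ag R y[symmetric] by (rule cancel[OF u(1)])
  have Q': "(\<Prod>r\<leftarrow>ps. phi_ratio a q (g / q) r) = Q * E / F"
  proof -
    have 1: "qpoch_inf (g / q * q / p) q = (1 - a * y / p) * qpoch_inf (g * q / p) q"
      "qpoch_inf (g / q * p / a) q = (1 - p * y / q) * qpoch_inf (p * y) q" for p
      using rec[of "g / p"] rec[of "p * y / q"] nz(1,2) by (simp_all add: ay y mult.commute)
    show ?thesis
      unfolding phi_ratio_def 1 prod_list_map_divide prod_list_map_mult Q_def E_def F_def by (simp add: mult_ac)
  qed
  have "(1 - a * (y / q)\<^sup>2) * qpoch_inf ((g / q)\<^sup>2 * q / a) q = (1 - g * y / q\<^sup>2) * ((1 - g * y / q) * qpoch_inf (g * y) q)"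
    using rec[of "g * y / q"] nz(1,2) by (simp add: y power2_eq_square mult_ac)
  then have S': "qpoch_inf ((g / q)\<^sup>2 * q / a) q = (1 - g * y / q\<^sup>2) * ((1 - g * y / q) * qpoch_inf (g * y) q) / (1 - a * (y / q)\<^sup>2)"
    unfolding sq' nonzero_eq_divide_eq[OF d(5)] by (simp only: mult.commute)
  have Y: "qpoch_inf (g / q / a) q = (1 - y / q) * qpoch_inf y q"
    using rec[of "y / q"] nz(2) by (simp add: y mult.commute)
  have R': "phi_ratio a q (g / q) (h * q) = (qpoch_inf (h * q) q * ((1 - a * y / (h * q)) * ((1 - a * y / h) * qpoch_inf (g * q / h) q)))
     / ((1 - a / h) * qpoch_inf (a * q / h) q * qpoch_inf (h * y) q)"
    using rec[of "g / (h * q)"] rec[of "g / h"] rec[of "a / h"] nz(1,2) unfolding phi_ratio_def by (simp add: y mult.commute)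
  have agq: "a / (g / q) = a * q / g"
    by simp
  have N1: "phi_factor i a (ps @ [g / q, h * q]) q / (1 - a * (y / q)\<^sup>2)
    = qpoch_inf (a * q) q * ((1 - y / q) * qpoch_inf y q) / ((1 - g * y / q\<^sup>2) * ((1 - g * y / q) * qpoch_inf (g * y) q) * qpoch_inf (a * q / g) q)
     * (Q * E / F)
     * ((qpoch_inf (h * q) q * ((1 - a * y / (h * q)) * ((1 - a * y / h) * qpoch_inf (g * q / h) q)))
     / ((1 - a / h) * qpoch_inf (a * q / h) q * qpoch_inf (h * y) q))"
    unfolding phi_factor_def Let_def sel list Q' S' Y R' agq by (rule cancel[OF u(2)])
  \<comment> \<open>With y = g / a both sides are (q - y)(y - 1) / y. This links the first factors
    split off at p / a and a / p before and after the shift.\<close>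
  have scalar: "q * (1 - y / q) * (1 - a / g) = (1 - a * q / g) * (1 - y)"
    using nz by (simp add: y field_simps)
  have "h1 * ah * (A * (yq * Y) / (u1 * (u2 * S) * T) * (Q * E / F) * (H * (u3 * (u4 * G)) / (ah * L * M))) * (q * F * u1) * u2
     = v * u4 * u3 * (A * Y / (S * (ag * T)) * Q * (h1 * H * G / (L * M))) * (y1 * E)"
    if "q * yq * ag = v * y1" "ag \<noteq> 0" "ah \<noteq> 0" "u1 \<noteq> 0" "u2 \<noteq> 0" "F \<noteq> 0"
    for h1 ah A yq Y u1 u2 S T F H u3 u4 G L M v ag y1
  proof -
    have "q * yq = v * y1 / ag"
      using that by (simp add: nonzero_eq_divide_eq)
    then have "(q * yq) * (h1 * (A * Y / (S * T) * (Q * E) * (H * (u3 * (u4 * G)) / (L * M))))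
      = v * u4 * u3 * (A * Y / (S * (ag * T)) * Q * (h1 * H * G / (L * M))) * (y1 * E)"
      by (simp add: mult_ac)
    moreover have "h1 * ah * (A * (yq * Y) / (u1 * (u2 * S) * T) * (Q * E / F) * (H * (u3 * (u4 * G)) / (ah * L * M))) * (q * F * u1) * u2
      = (q * yq) * (h1 * (A * Y / (S * T) * (Q * E) * (H * (u3 * (u4 * G)) / (L * M))))"
      using that by (simp add: mult_ac)
    ultimately show ?thesis
      by simp
  qed
  from this[OF scalar d(1,2,5,4) d(6)[folded F_def]] show ?thesis
    unfolding N0 N1 E_def[symmetric] F_def[symmetric] .
qed

locale contiguous_second_series_self =
  fixes a q g h :: complex and ps :: "complex list"
  assumes q: "norm q < 1" "q \<noteq> 0" and len: "length ps = 5" and nz: "g \<noteq> 0" "h \<noteq> 0"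
    and bal: "prod_list ps * g * h = a^3 * q\<^sup>2"
    and ne: "1 - h * q / g \<noteq> 0" "1 - g * q / h \<noteq> 0"
    and reg: "Phi_regular 5 a (ps @ [g, h]) q" "Phi_regular 5 a (ps @ [g / q, h * q]) q"
      "Phi_regular 5 a (ps @ [g * q, h / q]) q"

sublocale contiguous_second_series_self \<subseteq> three_term_relation
  "(1 - h) * (1 - a / h) * shift_coeff a q ps g h"
  "(1 - g) * (1 - a / g) * shift_coeff a q ps h g"
  "(1 - a * q / (g * h)) * (g - h) * (\<Prod>p\<leftarrow>ps. 1 - p)"
  "phi_second 5 a (ps @ [g, h]) q"
  "phi_second 5 a (ps @ [g / q, h * q]) q"
  "phi_second 5 a (ps @ [g * q, h / q]) q"
  "- ((1 - a * q / (g * h)) * ((1 - a * q / h) * (1 - a * q / g) * (g - h)) * wp_limit a q (ps @ [g, h]))"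
proof (unfold_locales, goal_cases)
  case 1
  define P0 where "P0 = phi_second 5 a (ps @ [g, h]) q"
  define P1 where "P1 = phi_second 5 a (ps @ [g / q, h * q]) q"
  define P2 where "P2 = phi_second 5 a (ps @ [g * q, h / q]) q"
  have "(1 - h) * (1 - a / h) * shift_coeff a q ps g h * (P1 - P0)
         - (1 - g) * (1 - a / g) * shift_coeff a q ps h g * (P2 - P0)
         + (1 - a * q / (g * h)) * (g - h) * (\<Prod>p\<leftarrow>ps. 1 - p) * P0
    = - ((1 - a * q / (g * h)) * ((1 - a * q / h) * (1 - a * q / g) * (g - h)) * wp_limit a q (ps @ [g, h]))"
  proof -
    define y where "y = g / a"
    have nth: "(ps @ [r, s]) ! 5 = r" for r s
      by (simp add: nth_append len)
    have i': "5 < length (ps @ [r, s])" "5 < length ps + 2" for r s :: complex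
      using len by simp_all
    have yq: "g / q / a = y / q" "g * q / a = y * q"
      by (simp_all add: y_def)
    note D0 = Phi_regularD[OF q(1) i'(1) reg(1), unfolded nth, folded y_def]
    note D1 = Phi_regularD[OF q(1) i'(1) reg(2), unfolded nth yq]
    note D2 = Phi_regularD[OF q(1) i'(1) reg(3), unfolded nth yq]
    have ay: "a * y = g" and ps0: "0 \<notin> set ps"
      using D0(1,3) by (auto simp: y_def)
    have w: "wp_regular a y q ps g h" "wp_regular a (y / q) q ps (g / q) (h * q)" "wp_regular a (y * q) q ps (g * q) (h / q)"
      using Phi_regular_imp_wp_regular(2)[OF q(1) i'(2) reg(1)] Phi_regular_imp_wp_regular(2)[OF q(1) i'(2) reg(2)]
        Phi_regular_imp_wp_regular(2)[OF q(1) i'(2) reg(3)]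
      unfolding nth yq y_def[symmetric] by blast+
    have S: "vwp_term a z q ps u v sums suminf (vwp_term a z q ps u v)" if "wp_regular a z q ps u v" for z u v
      using that by (intro summable_sums vwp_term_summable q)
    have unit: "1 - x \<noteq> 0" if "qpoch_inf x q \<noteq> 0" for x
      using qpoch_nonzero[OF q(1) that, of 1] by (simp add: qpoch_Suc)
    have unit': "1 - x \<noteq> 0" if "\<And>k. qpoch x q k \<noteq> 0" for x
      using that[of 1] by (simp add: qpoch_Suc)
    have ag: "1 - a / g \<noteq> 0" "1 - a / h \<noteq> 0" "1 - a / (g * q) \<noteq> 0" "1 - a * q / h \<noteq> 0"
      using unit[OF D0(10)] unit'[OF D1(6), of "h * q"] unit[OF D2(10)] unit'[OF D0(6), of h] q(2) by simp_all
    have y1: "1 - y \<noteq> 0"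
      using ag(1) D0(1,4) by (auto simp flip: ay)
    have gy: "1 - g * y \<noteq> 0" "1 - g * y / q\<^sup>2 \<noteq> 0" "1 - g * y / q \<noteq> 0" "1 - g * q * (y * q) \<noteq> 0" "1 - g * (y * q) \<noteq> 0"
    proof -
      show "1 - g * y \<noteq> 0" "1 - g * y / q\<^sup>2 \<noteq> 0" "1 - g * q * (y * q) \<noteq> 0"
        using unit[OF D0(9), of g] unit[OF D1(9), of "g / q"] unit[OF D2(9), of "g * q"] by (simp_all add: power2_eq_square)
      \<comment> \<open>These two facts concern second factors: 1 - g y / q in the infinite product
        with base point g y / q^2, and 1 - g y q in the one with base point g y.\<close>
      have "qpoch_inf (g / q * (y / q)) q \<noteq> 0" "qpoch_inf (g * y) q \<noteq> 0"
        using D1(9)[of "g / q"] D0(9)[of g] by simp_all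
      then have "qpoch_inf (g / q * (y / q) * q) q \<noteq> 0" "qpoch_inf (g * y * q) q \<noteq> 0"
        using qpoch_inf_rec[OF q(1), of "g / q * (y / q)"] qpoch_inf_rec[OF q(1), of "g * y"] by auto
      then show "1 - g * y / q \<noteq> 0" "1 - g * (y * q) \<noteq> 0"
        using unit[of "g / q * (y / q) * q"] unit[of "g * y * q"] q(2) by (simp_all add: mult.assoc)
    qed
    have F: "(\<Prod>p\<leftarrow>ps. 1 - p * y / q) \<noteq> 0" "(\<Prod>p\<leftarrow>ps. 1 - p * y) \<noteq> 0"
    proof -
      have F: "1 - p * y / q \<noteq> 0" "1 - p * y \<noteq> 0" if "p \<in> set ps" for p
        using unit[OF D1(9), of p] unit[OF D0(9), of p] that by simp_all
      show "(\<Prod>p\<leftarrow>ps. 1 - p * y / q) \<noteq> 0" "(\<Prod>p\<leftarrow>ps. 1 - p * y) \<noteq> 0"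
        by (rule prod_list_map_nonzero, erule F)+
    qed
    define n0 where "n0 = phi_factor 5 a (ps @ [g, h]) q / (1 - a * y\<^sup>2)"
    define n1 where "n1 = phi_factor 5 a (ps @ [g / q, h * q]) q / (1 - a * (y / q)\<^sup>2)"
    define n2 where "n2 = phi_factor 5 a (ps @ [g * q, h / q]) q / (1 - a * (y * q)\<^sup>2)"
    have P: "P0 = n0 * suminf (vwp_term a y q ps g h)"
      unfolding P0_def n0_def by (rule phi_second_eq[OF q(1) i'(2) reg(1) S[OF w(1)]]) (simp only: nth y_def)
    have P': "P1 = n1 * suminf (vwp_term a (y / q) q ps (g / q) (h * q))"
      unfolding P1_def n1_def by (rule phi_second_eq[OF q(1) i'(2) reg(2) S[OF w(2)]]) (simp only: nth yq)
    have P'': "P2 = n2 * suminf (vwp_term a (y * q) q ps (g * q) (h / q))"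
      unfolding P2_def n2_def by (rule phi_second_eq[OF q(1) i'(2) reg(3) S[OF w(3)]]) (simp only: nth yq)
    have "y * ((1 - h) * (1 - a / h) * shift_coeff a q ps g h * (P1 - P0)
           - (1 - g) * (1 - a / g) * shift_coeff a q ps h g * (P2 - P0)
           + (1 - a * q / (g * h)) * (g - h) * (\<Prod>p\<leftarrow>ps. 1 - p) * P0)
      = (1 - a * q / (g * h)) * ((1 - a * q / h) * (1 - a * q / g) * (g - h))
        * (n0 * ((1 - a * y) * (\<Prod>p\<leftarrow>ps. 1 - p * y)
             / ((1 - q * y) * (\<Prod>p\<leftarrow>ps. 1 - a * q * y / p) * (1 - a * q * y / g) * (1 - a * q * y / h)))
           * wp_ratio_inf a (y * q) q ps g h)"
      unfolding P P' P''
    proof (rule contiguous_grid_self[OF q(1) D0(4) ay y1 len ps0 D0(1) q(2) nz bal ne w gy(3,2) F(1)])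
      show "(1 - h) * (1 - a / h) * n1 * (q * (\<Prod>p\<leftarrow>ps. 1 - p * y / q) * (1 - g * y / q\<^sup>2)) * (1 - g * y / q)
        = (1 - a * q / g) * (1 - a * y / h) * (1 - a * y / (h * q)) * n0 * ((1 - y) * (\<Prod>p\<leftarrow>ps. 1 - a * y / p))"
        unfolding n0_def n1_def
        by (rule phi_factor_self_shift[OF q(1) D0(1) q(2) nz len[symmetric] y_def ag(1,2) gy(1,3,2) F(1)])
      have arg: "g * q / q = g" "h / q * q = h" "a * q / (g * q) = a / g" "a / (h / q) = a * q / h" "y * q / q = y"
        "g * q * (y * q) / q\<^sup>2 = g * y" "g * q * (y * q) / q = g * (y * q)"
        "a * (y * q) / p = a * q * y / p" for p
        using q(2) by (simp_all add: power2_eq_square)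
      have arg': "p * (y * q) / q = p * y" "a * q * y / (h / q) = a * q * (y * q) / h" for p
        using q(2) by simp_all
      \<comment> \<open>The weight \<open>n2\<close> comes from the same lemma applied to (g q, h /
        q), whose shift leads back to (g, h).\<close>
      have "(1 - h / q) * (1 - a * q / h) * n0 * (q * (\<Prod>p\<leftarrow>ps. 1 - p * y) * (1 - g * y)) * (1 - g * (y * q))
        = (1 - a / g) * (1 - a * q * (y * q) / h) * (1 - a * q * y / h) * n2 * ((1 - y * q) * (\<Prod>p\<leftarrow>ps. 1 - a * q * y / p))"
      proof -
        have "g * q \<noteq> 0" "h / q \<noteq> 0" "y * q = g * q / a"
          using nz q(2) by (simp_all add: y_def)
        moreover have "1 - a / (h / q) \<noteq> 0" "1 - g * q * (y * q) / q \<noteq> 0" "1 - g * q * (y * q) / q\<^sup>2 \<noteq> 0"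
          "(\<Prod>p\<leftarrow>ps. 1 - p * (y * q) / q) \<noteq> 0"
          unfolding arg unfolding arg' by (fact ag(4) gy(5) gy(1) F(2))+
        ultimately show ?thesis
          using phi_factor_self_shift[OF q(1) D0(1) q(2) _ _ len[symmetric] _ ag(3) _ gy(4), of "h / q"]
          unfolding arg unfolding arg' n0_def n2_def by blast
      qed
      then show "(1 - a / g) * n2 * ((1 - a * q * (y * q) / h) * (1 - q * y) * (\<Prod>p\<leftarrow>ps. 1 - a * q * y / p) * (1 - a * q * y / h))
        = (1 - h / q) * (1 - a * q / h) * ((1 - g * (y * q)) * (1 - g * y)) * n0 * (q * (\<Prod>p\<leftarrow>ps. 1 - p * y))"
        by (simp only: mult_ac)
    qed (intro S w)+
    \<comment> \<open>The factors at y complete the infinite products on the grid from y q to those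
      on the grid from y, which brings the expression into the form of
      \<open>phi_factor_limit\<close>.\<close>
    also have "n0 * ((1 - a * y) * (\<Prod>p\<leftarrow>ps. 1 - p * y)
             / ((1 - q * y) * (\<Prod>p\<leftarrow>ps. 1 - a * q * y / p) * (1 - a * q * y / g) * (1 - a * q * y / h)))
           * wp_ratio_inf a (y * q) q ps g h
      = - y * wp_limit a q (ps @ [g, h])"
    proof -
      have rec: "qpoch_inf (p * y) q = (1 - p * y) * qpoch_inf (p * (y * q)) q"
        "qpoch_inf (a * q * y / p) q = (1 - a * q * y / p) * qpoch_inf (a * q * (y * q) / p) q" for p
        using qpoch_inf_rec[OF q(1), of "p * y"] qpoch_inf_rec[OF q(1), of "a * q * y / p"] by (simp_all add: mult_ac)
      have args: "g * (y * q) / q = g * y" "h * (y * q) / q = h * y"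
        using q(2) by simp_all
      have "n0 * ((1 - a * y) * (\<Prod>p\<leftarrow>ps. 1 - p * y)
             / ((1 - q * y) * (\<Prod>p\<leftarrow>ps. 1 - a * q * y / p) * (1 - a * q * y / g) * (1 - a * q * y / h)))
           * wp_ratio_inf a (y * q) q ps g h
        = n0 * (((1 - a * y) * qpoch_inf (a * (y * q)) q) * (\<Prod>p\<leftarrow>ps. (1 - p * y) * qpoch_inf (p * (y * q)) q) * qpoch_inf (g * y) q * qpoch_inf (h * y) q)
         / (((1 - q * y) * qpoch_inf (q * (y * q)) q) * (\<Prod>p\<leftarrow>ps. (1 - a * q * y / p) * qpoch_inf (a * q * (y * q) / p) q)
             * ((1 - a * q * y / g) * qpoch_inf (a * q * (y * q) / g) q) * ((1 - a * q * y / h) * qpoch_inf (a * q * (y * q) / h) q))"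
        unfolding wp_ratio_inf_def args prod_list_map_mult
        by (simp only: times_divide_times_eq times_divide_eq_left times_divide_eq_right divide_divide_eq_left mult_ac)
      also have "\<dots> = n0 * (qpoch_inf (a * y) q * (\<Prod>r\<leftarrow>ps @ [g, h]. qpoch_inf (r * y) q))
        / (qpoch_inf (q * y) q * (\<Prod>r\<leftarrow>ps @ [g, h]. qpoch_inf (a * q * y / r) q))"
        unfolding rec[symmetric] by (simp add: mult.assoc)
      also have "\<dots> = - y * wp_limit a q (ps @ [g, h])"
        using phi_factor_limit[OF q(1) i'(1) reg(1)] unfolding n0_def nth y_def .
      finally show ?thesis .
    qed
    finally have "y * ((1 - h) * (1 - a / h) * shift_coeff a q ps g h * (P1 - P0)
           - (1 - g) * (1 - a / g) * shift_coeff a q ps h g * (P2 - P0)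
           + (1 - a * q / (g * h)) * (g - h) * (\<Prod>p\<leftarrow>ps. 1 - p) * P0)
      = y * - ((1 - a * q / (g * h)) * ((1 - a * q / h) * (1 - a * q / g) * (g - h)) * wp_limit a q (ps @ [g, h]))"
      by (simp only: mult_ac mult_minus_left mult_minus_right)
    then show ?thesis
      using D0(4) mult_left_cancel by blast
  qed
  then show ?case
    unfolding P0_def P1_def P2_def .
qed

lemmas (in contiguous_second_series_self) three_term = three_term_relation_axioms

section \<open>The relation for Phi and the exchange of g and h\<close>

lemma contiguous_Phi:
  assumes q: "norm q < 1" "q \<noteq> 0" and len: "length ps = 5" and i: "i < 6"
    and bal: "prod_list ps * g * h = a^3 * q\<^sup>2"
    and ne: "1 - h * q / g \<noteq> 0" "1 - g * q / h \<noteq> 0"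
    and reg: "Phi_regular i a (ps @ [g, h]) q" "Phi_regular i a (ps @ [g / q, h * q]) q"
      "Phi_regular i a (ps @ [g * q, h / q]) q"
  defines "F0 \<equiv> Phi i a (ps @ [g, h]) q" and "F1 \<equiv> Phi i a (ps @ [g / q, h * q]) q"
    and "F2 \<equiv> Phi i a (ps @ [g * q, h / q]) q"
  shows "(1 - h) * (1 - a / h) * shift_coeff a q ps g h * (F1 - F0)
         - (1 - g) * (1 - a / g) * shift_coeff a q ps h g * (F2 - F0)
         + (1 - a * q / (g * h)) * (g - h) * (\<Prod>p\<leftarrow>ps. 1 - p) * F0 = 0"
proof -
  have i': "i < length (ps @ [r, s])" "i < length ps + 2" for r s :: complex
    using i len by simp_all
  note D = Phi_regularD[OF q(1) i'(1) reg(1)]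
  have nz: "g \<noteq> 0" "h \<noteq> 0" "0 \<notin> set ps"
    using D(3) by auto
  note w = Phi_regular_imp_wp_regular(1)[OF q(1) i'(2) reg(1)] Phi_regular_imp_wp_regular(1)[OF q(1) i'(2) reg(2)]
    Phi_regular_imp_wp_regular(1)[OF q(1) i'(2) reg(3)]
  let ?A = "(1 - h) * (1 - a / h) * shift_coeff a q ps g h" and ?B = "(1 - g) * (1 - a / g) * shift_coeff a q ps h g"
    and ?C = "(1 - a * q / (g * h)) * (g - h) * (\<Prod>p\<leftarrow>ps. 1 - p)"
    and ?L = "(1 - a * q / (g * h)) * ((1 - a * q / h) * (1 - a * q / g) * (g - h)) * wp_limit a q (ps @ [g, h])"
  have first: "three_term_relation ?A ?B ?C (W10_9 a (ps @ [g, h]) q) (W10_9 a (ps @ [g / q, h * q]) q)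
      (W10_9 a (ps @ [g * q, h / q]) q) ?L"
    by (intro contiguous_first_series.three_term contiguous_first_series.intro
        q(1) len nz(3) D(1) q(2) nz(1,2) D(2) bal ne w)
  consider "i < 5" | "i = 5"
    using i by linarith
  then have "three_term_relation ?A ?B ?C (phi_second i a (ps @ [g, h]) q) (phi_second i a (ps @ [g / q, h * q]) q)
      (phi_second i a (ps @ [g * q, h / q]) q) (- ?L)"
  proof cases
    case 1
    show ?thesis
      by (intro contiguous_second_series.three_term contiguous_second_series.intro
          q len nz(1,2) bal ne 1 reg)
  next
    case 2
    show ?thesis
      unfolding 2 by (intro contiguous_second_series_self.three_term
          contiguous_second_series_self.intro q len nz(1,2) bal ne reg[unfolded 2])
  qed
  from three_term_relation.relation_add[OF first this] show ?thesis
    unfolding F0_def F1_def F2_def Phi_eq .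
qed

text \<open>Both series and the prefactor are symmetric in the parameters that are not
  distinguished, so a distinguished h is reduced to a distinguished g.\<close>

lemma Phi_swap:
  assumes "length ps = 5"
  shows "Phi 6 a (ps @ [g, h]) q = Phi 5 a (ps @ [h, g]) q"
  using assms by (simp add: Phi_def W10_9_def others_def nth_append mult_ac)

lemma Phi_regular_swap:
  assumes "length ps = 5"
  shows "Phi_regular 6 a (ps @ [g, h]) q = Phi_regular 5 a (ps @ [h, g]) q"
  using assms by (simp add: Phi_regular_def W10_9_regular_def others_def nth_append conj_ac)

theorem theorem2p4:
  fixes q a b c d e f g h :: complex and i :: nat
  assumes "0 < norm q" and "norm q < 1"
    and "a \<noteq> 0" "b \<noteq> 0" "c \<noteq> 0" "d \<noteq> 0" "e \<noteq> 0" "f \<noteq> 0" "g \<noteq> 0" "h \<noteq> 0"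
    and "b * c * d * e * f * g * h = a ^ 3 * q\<^sup>2"
    and "i < 7"
    and "Phi_regular i a [b, c, d, e, f, g, h] q"
    and "Phi_regular i a [b, c, d, e, f, g / q, h * q] q"
    and "Phi_regular i a [b, c, d, e, f, g * q, h / q] q"
    and "1 - h * q / g \<noteq> 0" and "1 - g * q / h \<noteq> 0"
  shows
    "g * (1 - h) * (1 - a / h) * (1 - a * q / h) * (\<Prod>p\<leftarrow>[b, c, d, e, f]. 1 - a * q / (g * p))
       / (1 - h * q / g)
       * (Phi i a [b, c, d, e, f, g / q, h * q] q - Phi i a [b, c, d, e, f, g, h] q)
     - h * (1 - g) * (1 - a / g) * (1 - a * q / g) * (\<Prod>p\<leftarrow>[b, c, d, e, f]. 1 - a * q / (h * p))
       / (1 - g * q / h)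
       * (Phi i a [b, c, d, e, f, g * q, h / q] q - Phi i a [b, c, d, e, f, g, h] q)
     - a * q / h * (1 - h / g) * (1 - g * h / (a * q))
       * (1 - b) * (1 - c) * (1 - d) * (1 - e) * (1 - f)
       * Phi i a [b, c, d, e, f, g, h] q = 0"
proof -
  define ps where "ps = [b, c, d, e, f]"
  have len: "length ps = 5"
    by (simp add: ps_def)
  have ms: "[b, c, d, e, f, u, v] = ps @ [u, v]" for u v
    by (simp add: ps_def)
  have q: "norm q < 1" "q \<noteq> 0"
    using assms(1,2) by auto
  have bal: "prod_list ps * g * h = a ^ 3 * q\<^sup>2" "prod_list ps * h * g = a ^ 3 * q\<^sup>2"
    using assms(11) by (simp_all add: ps_def mult_ac)
  note reg = assms(13-15)[unfolded ms]
  let ?F0 = "Phi i a (ps @ [g, h]) q" and ?F1 = "Phi i a (ps @ [g / q, h * q]) q" and ?F2 = "Phi i a (ps @ [g * q, h / q]) q"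
  have main: "(1 - h) * (1 - a / h) * shift_coeff a q ps g h * (?F1 - ?F0)
         - (1 - g) * (1 - a / g) * shift_coeff a q ps h g * (?F2 - ?F0)
         + (1 - a * q / (g * h)) * (g - h) * (\<Prod>p\<leftarrow>ps. 1 - p) * ?F0 = 0"
  proof (cases "i = 6")
    case False
    then have "i < 6"
      using assms(12) by simp
    from contiguous_Phi[OF q len this bal(1) assms(16,17) reg] show ?thesis .
  next
    case True
    have "(1 - g) * (1 - a / g) * shift_coeff a q ps h g * (?F2 - ?F0)
         - (1 - h) * (1 - a / h) * shift_coeff a q ps g h * (?F1 - ?F0)
         + (1 - a * q / (h * g)) * (h - g) * (\<Prod>p\<leftarrow>ps. 1 - p) * ?F0 = 0"
      using contiguous_Phi[OF q len, of 5 h g a] bal(2) assms(16,17) reg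
      unfolding True Phi_swap[OF len] Phi_regular_swap[OF len] by simp
    \<comment> \<open>Exchanging g and h interchanges the two differences and turns g - h into h -
      g, so the relation only changes sign.\<close>
    moreover have "A * x - B * y + K * (g - h) * P * z = 0" if "B * y - A * x + K * (h - g) * P * z = 0"
      for A B K P x y z
    proof -
      have "A * x - B * y + K * (g - h) * P * z = - (B * y - A * x + K * (h - g) * P * z)"
        by (simp add: algebra_simps)
      then show ?thesis
        unfolding that by simp
    qed
    ultimately show ?thesis
      unfolding mult.commute[of h g] by blast
  qed
  \<comment> \<open>Accounts for the minus sign of the third term in the theorem.\<close>
  have coeff: "(1 - a * q / (g * h)) * (g - h) = - (a * q / h * (1 - h / g) * (1 - g * h / (a * q)))"
    using assms(3,9,10) q(2) by (simp add: field_simps)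
  show ?thesis
    using main unfolding coeff shift_coeff_def ms unfolding ps_def by (simp add: mult_ac)
qed

end
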